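(* Consider non-coherent downlink transmission with MR precoding based either on the LMMSE estimator, $w_{m,k}=\hat h^{\mathrm{lmmse}}_{m,k}/\sqrt{\mathbb E\{|\hat h^{\mathrm{lmmse}}_{m,k}|^2\}}$ for all $m,k$, or on the LS estimator, $w_{m,k}=\hat h^{\mathrm{ls}}_{m,k}/\sqrt{\mathbb E\{|\hat h^{\mathrm{ls}}_{m,k}|^2\}}$ for all $m,k$. Here $\mathbb E\{|\hat h^{\mathrm{lmmse}}_{m,k}|^2\}=\hat p_k\tau_p(\beta'_{m,k})^2(\lambda'_{m,k})^{-1}$ and $\mathbb E\{|\hat h^{\mathrm{ls}}_{m,k}|^2\}=\frac{1}{\hat p_k\tau_p}\lambda'_{m,k}$, and the two precoders coincide. In both cases, for all APs $n$ and UEs $k,l$: $$\mathbb E\{h_{n,k}^*w_{n,k}\}=\sqrt{\hat p_k\tau_p(\beta'_{n,k})^2(\lambda'_{n,k})^{-1}},$$ $$\mathbb E\{|h_{n,k}^*w_{n,l}|^2\}=\beta'_{n,k}+\begin{cases}\hat p_k\tau_p(\lambda'_{n,l})^{-1}\big(\beta_{n,k}^2+2\bar h_{n,k}^2\beta_{n,k}\big),& l\in\mathcal P_k,\\ 0,& l\notin\mathcal P_k.\end{cases}$$ Consequently the non-coherent downlink effective SINR of UE $k$ is the same for the LMMSE and LS estimators and equals $$\gamma^{\mathrm{dl,lmmse}}_k=\gamma^{\mathrm{dl,ls}}_k=\frac{\hat p_k\tau_p\mathrm{tr}(\mathbf D_k\boldsymbol\Omega'_k)}{\sum_{l=1}^K\mathrm{tr}(\mathbf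 D_l\mathbf R'_k)+\sum_{l\in\mathcal P_k}\hat p_k\tau_p\mathrm{tr}\big(\mathbf D_l\boldsymbol\Lambda'_l(\mathbf R_k^2+2\mathbf R_k\mathbf L_k)\big)-\hat p_k\tau_p\mathrm{tr}(\mathbf D_k\boldsymbol\Omega'_k)+\sigma^2_{\mathrm{dl}}},$$ where $\mathbf D_k=\mathrm{diag}(\rho_{1,k},\dots,\rho_{M,k})$.
   Context: Channels. There are $M$ single-antenna access points (APs) and $K$ single-antenna users (UEs). The channel between AP $m$ and UE $k$ is $h_{m,k}=\bar h_{m,k}e^{j\varphi_{m,k}}+g_{m,k}$, with $\bar h_{m,k}\ge 0$ deterministic, $\varphi_{m,k}$ uniform on $[-\pi,\pi]$, $g_{m,k}\sim\mathcal N_{\mathbb C}(0,\beta_{m,k})$ (circularly symmetric complex Gaussian), $\beta_{m,k}>0$; all $\varphi_{m,k},g_{m,k}$ are mutually independent over $m,k$. Pilots. $\tau_p<K$ is the pilot length. Each UE uses one of $\tau_p$ mutually orthogonal pilot sequences $\boldsymbol\phi_k\in\mathbb C^{\tau_p}$ with $\|\boldsymbol\phi_k\|^2=\tau_p$, with pilot power $\hat p_k>0$. $\mathcal P_k$ is the set of UEs using the same pilot as UE $k$ (including $k$). After correlation with the pilot, AP $m$ has $$y^p_{m,k}=\sum_{l\in\mathcal P_k}\sqrt{\hat p_l}\,\tau_p h_{m,l}+\boldsymbol\phi_k^H\mathbf n^p_m,$$ where the $\mathbf n^p_m\sim\mathcal N_{\mathbb C}(\mathbf 0,\sigma^2_{\mathrm{ul}}\mathbf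 I_{\tau_p})$ are independent over $m$ and independent of all channels, and $\sigma^2_{\mathrm{ul}}>0$. Estimators. LMMSE: $\hat h^{\mathrm{lmmse}}_{m,k}=\sqrt{\hat p_k}\,\beta'_{m,k}y^p_{m,k}/\lambda'_{m,k}$. LS: $\hat h^{\mathrm{ls}}_{m,k}=\frac{1}{\sqrt{\hat p_k}\,\tau_p}y^p_{m,k}$. Here $\beta'_{m,k}=\beta_{m,k}+\bar h_{m,k}^2$ and $\lambda'_{m,k}=\sum_{l\in\mathcal P_k}\hat p_l\tau_p\beta'_{m,l}+\sigma^2_{\mathrm{ul}}$. Matrices (all $M\times M$ diagonal): $\mathbf R_k=\mathrm{diag}(\beta_{1,k},\dots,\beta_{M,k})$, $\mathbf L_k=\mathrm{diag}(\bar h_{1,k}^2,\dots,\bar h_{M,k}^2)$, $\mathbf R'_k=\mathbf R_k+\mathbf L_k$, $\boldsymbol\Lambda'_k=\mathrm{diag}(\lambda'_{1,k},\dots,\lambda'_{M,k})^{-1}$, $\boldsymbol\Omega'_k=\mathbf R'_k\boldsymbol\Lambda'_k\mathbf R'_k$. Non-coherent downlink. AP $m$ sends $\sum_k w_{m,k}\varsigma_{m,k}$, where the data symbols $\varsigma_{m,k}\sim\mathcal N_{\mathbb C}(0,\rho_{m,k})$ are independent over $m,k$, $\rho_{m,k}\ge0$ deterministic with $\sum_l\rho_{m,l}\le\rho^{\mathrm{dl}}$; the receiver noise variance is $\sigma^2_{\mathrm{dl}}>0$. The non-coherent downlink effective SINR of UE $k$ (giving SE $\frac{\tau_d}{\tau_c}\log_2(1+\gamma)$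 under successive interference cancellation) is defined as $$\gamma^{\mathrm{dl,nc}}_k=\frac{\sum_{n=1}^M\rho_{n,k}|\mathbb E\{h_{n,k}^*w_{n,k}\}|^2}{\sum_{n=1}^M\sum_{l=1}^K\rho_{n,l}\mathbb E\{|h_{n,k}^*w_{n,l}|^2\}-\sum_{n=1}^M\rho_{n,k}|\mathbb E\{h_{n,k}^*w_{n,k}\}|^2+\sigma^2_{\mathrm{dl}}}.$$ *)

theory Defs
  imports "HOL-Probability.Probability"
begin

text \<open>
  Access points, users and pilot symbols are indexed by finite types \<open>'m\<close>, \<open>'k\<close>, \<open>'t\<close>, so that
  \<open>M = CARD('m)\<close>, \<open>K = CARD('k)\<close> and \<open>\<tau>\<^sub>p = CARD('t)\<close>. A pilot book of \<open>\<tau>\<^sub>p\<close> sequences of length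
  \<open>\<tau>\<^sub>p\<close> is a function \<open>'t \<Rightarrow> complex^'t\<close>, and \<open>pidx k\<close> is the index of the pilot of user \<open>k\<close>.
\<close>

section \<open>Distributions\<close>

text \<open>The circularly symmetric law \<open>N\<^sub>C(0, v)\<close> with \<open>E |z|\<^sup>2 = v\<close> (variance \<open>v / 2\<close> per real
  component); it degenerates to the point mass at 0 for \<open>v = 0\<close>.\<close>

definition complex_normal :: "real \<Rightarrow> complex measure" where
  "complex_normal v =
     (if v = 0 then return borel 0
      else density lborel (\<lambda>z. ennreal (exp (- (cmod z)\<^sup>2 / v) / (pi * v))))"

text \<open>The law \<open>N\<^sub>C(0, v I)\<close> on \<open>complex^'t\<close>, for \<open>v > 0\<close>; \<open>norm\<close> is the Hermitian norm.\<close>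

definition complex_normal_vec :: "real \<Rightarrow> (complex ^ 't::finite) measure" where
  "complex_normal_vec v =
     density lborel (\<lambda>x. ennreal (exp (- (norm x)\<^sup>2 / v) / (pi * v) ^ CARD('t)))"

definition has_law :: "'w measure \<Rightarrow> ('w \<Rightarrow> 'a::topological_space) \<Rightarrow> 'a measure \<Rightarrow> bool" where
  "has_law P X \<mu> \<longleftrightarrow> X \<in> borel_measurable P \<and> distr P borel X = \<mu>"

text \<open>Mutual independence of all phases, all scattered components and all pilot noise vectors.
  These take values in different types, so \<open>indep_vars\<close> does not apply directly; the following is
  its characterisation through the events generated by each variable.\<close>

datatype ('m, 'k) source = Phase 'm 'k | Scatter 'm 'k | Pilot_Noise 'm

definition var_events :: "'w measure \<Rightarrow> ('w \<Rightarrow> 'a::topological_space) \<Rightarrow> 'w set set" where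
  "var_events P X = {X -` A \<inter> space P |A. A \<in> sets borel}"

definition indep_sources ::
  "'w measure \<Rightarrow> ('m \<Rightarrow> 'k \<Rightarrow> 'w \<Rightarrow> real) \<Rightarrow> ('m \<Rightarrow> 'k \<Rightarrow> 'w \<Rightarrow> complex) \<Rightarrow>
   ('m \<Rightarrow> 'w \<Rightarrow> complex ^ 't::finite) \<Rightarrow> bool" where
  "indep_sources P phase g nz \<longleftrightarrow>
     prob_space.indep_sets P
       (\<lambda>s. case s of
              Phase m k \<Rightarrow> var_events P (phase m k)
            | Scatter m k \<Rightarrow> var_events P (g m k)
            | Pilot_Noise m \<Rightarrow> var_events P (nz m))
       UNIV"

section \<open>Channels, pilots and estimators\<close>

definition channel ::
  "('m \<Rightarrow> 'k \<Rightarrow> real) \<Rightarrow> ('m \<Rightarrow> 'k \<Rightarrow> 'w \<Rightarrow> real) \<Rightarrow> ('m \<Rightarrow> 'k \<Rightarrow> 'w \<Rightarrow> complex) \<Rightarrow>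
   'm \<Rightarrow> 'k \<Rightarrow> 'w \<Rightarrow> complex" where
  "channel hbar phase g m k \<omega> =
     complex_of_real (hbar m k) * exp (\<i> * complex_of_real (phase m k \<omega>)) + g m k \<omega>"

text \<open>\<open>x\<^sup>H y\<close>\<close>

definition herm_inner :: "complex ^ 't::finite \<Rightarrow> complex ^ 't \<Rightarrow> complex" where
  "herm_inner x y = (\<Sum>i\<in>UNIV. cnj (x $ i) * (y $ i))"

definition orthogonal_pilots :: "('t::finite \<Rightarrow> complex ^ 't) \<Rightarrow> bool" where
  "orthogonal_pilots pilots \<longleftrightarrow>
     (\<forall>s. (norm (pilots s))\<^sup>2 = real CARD('t)) \<and>
     (\<forall>s s'. s \<noteq> s' \<longrightarrow> herm_inner (pilots s) (pilots s') = 0)"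

definition pilot_group :: "('k \<Rightarrow> 't) \<Rightarrow> 'k \<Rightarrow> 'k set" where
  "pilot_group pidx k = {l. pidx l = pidx k}"

definition pilot_obs ::
  "('t::finite \<Rightarrow> complex ^ 't) \<Rightarrow> ('k::finite \<Rightarrow> 't) \<Rightarrow> ('k \<Rightarrow> real) \<Rightarrow>
   ('m \<Rightarrow> 'k \<Rightarrow> 'w \<Rightarrow> complex) \<Rightarrow> ('m \<Rightarrow> 'w \<Rightarrow> complex ^ 't) \<Rightarrow> 'm \<Rightarrow> 'k \<Rightarrow> 'w \<Rightarrow> complex" where
  "pilot_obs pilots pidx phat h nz m k \<omega> =
     (\<Sum>l\<in>pilot_group pidx k. complex_of_real (sqrt (phat l) * real CARD('t)) * h m l \<omega>)
     + herm_inner (pilots (pidx k)) (nz m \<omega>)"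

definition beta' :: "('m \<Rightarrow> 'k \<Rightarrow> real) \<Rightarrow> ('m \<Rightarrow> 'k \<Rightarrow> real) \<Rightarrow> 'm \<Rightarrow> 'k \<Rightarrow> real" where
  "beta' hbar \<beta> m k = \<beta> m k + (hbar m k)\<^sup>2"

definition lambda' ::
  "('m \<Rightarrow> 'k \<Rightarrow> real) \<Rightarrow> ('m \<Rightarrow> 'k \<Rightarrow> real) \<Rightarrow> ('k::finite \<Rightarrow> 't::finite) \<Rightarrow> ('k \<Rightarrow> real) \<Rightarrow> real \<Rightarrow>
   'm \<Rightarrow> 'k \<Rightarrow> real" where
  "lambda' hbar \<beta> pidx phat var_ul m k =
     (\<Sum>l\<in>pilot_group pidx k. phat l * real CARD('t) * beta' hbar \<beta> m l) + var_ul"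

definition lmmse_est ::
  "('m \<Rightarrow> 'k \<Rightarrow> real) \<Rightarrow> ('m \<Rightarrow> 'k \<Rightarrow> real) \<Rightarrow> ('k::finite \<Rightarrow> 't::finite) \<Rightarrow> ('k \<Rightarrow> real) \<Rightarrow> real \<Rightarrow>
   ('m \<Rightarrow> 'k \<Rightarrow> 'w \<Rightarrow> complex) \<Rightarrow> 'm \<Rightarrow> 'k \<Rightarrow> 'w \<Rightarrow> complex" where
  "lmmse_est hbar \<beta> pidx phat var_ul y m k \<omega> =
     complex_of_real (sqrt (phat k) * beta' hbar \<beta> m k) * y m k \<omega>
     / complex_of_real (lambda' hbar \<beta> pidx phat var_ul m k)"

text \<open>The first argument is the pilot length.\<close>

definition ls_est ::
  "nat \<Rightarrow> ('k \<Rightarrow> real) \<Rightarrow> ('m \<Rightarrow> 'k \<Rightarrow> 'w \<Rightarrow> complex) \<Rightarrow> 'm \<Rightarrow> 'k \<Rightarrow> 'w \<Rightarrow> complex" where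
  "ls_est \<tau> phat y m k \<omega> = complex_of_real (1 / (sqrt (phat k) * real \<tau>)) * y m k \<omega>"

section \<open>Maximum-ratio precoding and non-coherent downlink SINR\<close>

definition mean_power :: "'w measure \<Rightarrow> ('w \<Rightarrow> complex) \<Rightarrow> real" where
  "mean_power P X = prob_space.expectation P (\<lambda>\<omega>. (cmod (X \<omega>))\<^sup>2)"

definition mr_precoder ::
  "'w measure \<Rightarrow> ('m \<Rightarrow> 'k \<Rightarrow> 'w \<Rightarrow> complex) \<Rightarrow> 'm \<Rightarrow> 'k \<Rightarrow> 'w \<Rightarrow> complex" where
  "mr_precoder P hhat m k \<omega> =
     hhat m k \<omega> / complex_of_real (sqrt (mean_power P (hhat m k)))"

definition sinr_dl_nc ::
  "'w measure \<Rightarrow> ('m::finite \<Rightarrow> 'k::finite \<Rightarrow> real) \<Rightarrow> real \<Rightarrow>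
   ('m \<Rightarrow> 'k \<Rightarrow> 'w \<Rightarrow> complex) \<Rightarrow> ('m \<Rightarrow> 'k \<Rightarrow> 'w \<Rightarrow> complex) \<Rightarrow> 'k \<Rightarrow> real" where
  "sinr_dl_nc P \<rho> var_dl h w k =
     (\<Sum>n\<in>UNIV. \<rho> n k * (cmod (prob_space.expectation P (\<lambda>\<omega>. cnj (h n k \<omega>) * w n k \<omega>)))\<^sup>2)
     / ((\<Sum>n\<in>UNIV. \<Sum>l\<in>UNIV. \<rho> n l * mean_power P (\<lambda>\<omega>. cnj (h n k \<omega>) * w n l \<omega>))
        - (\<Sum>n\<in>UNIV. \<rho> n k * (cmod (prob_space.expectation P (\<lambda>\<omega>. cnj (h n k \<omega>) * w n k \<omega>)))\<^sup>2)
        + var_dl)"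

definition diag_mat :: "('m::finite \<Rightarrow> real) \<Rightarrow> real ^ 'm ^ 'm" where
  "diag_mat d = (\<chi> i j. if i = j then d i else 0)"

end

theory Submission
  imports Defs
begin

text \<open>
  Up to a positive constant both precoders equal the pilot observation \<open>y\<close> divided by its
  root mean power, so they coincide. At a fixed access point \<open>y\<close> is a real linear combination of
  independent zero-mean variables, namely the channels of the users sharing the pilot and the
  correlated noise. Hence \<open>h\<close> and \<open>y\<close> interact only through the coefficient \<open>a\<close> of \<open>h\<close> in \<open>y\<close>:
  \<open>E(h\<^sup>* y) = a E\<bar>h\<bar>\<^sup>2\<close> and \<open>E\<bar>h\<^sup>* y\<bar>\<^sup>2 = E\<bar>h\<bar>\<^sup>2 E\<bar>y\<bar>\<^sup>2 + a\<^sup>2 (E\<bar>h\<bar>\<^sup>4 - (E\<bar>h\<bar>\<^sup>2)\<^sup>2)\<close>, where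
  the last bracket is \<open>\<beta>\<^sup>2 + 2 hbar\<^sup>2 \<beta>\<close> for a Rician channel.
\<close>

section \<open>Isotropic Gaussian moments\<close>

text \<open>Fubini: \<open>lborel\<close> on a Euclidean space is the image of the product of real
  Lebesgue measures over \<open>Basis\<close> under the map from coordinates to vectors.\<close>

lemma has_bochner_integral_lborel_prod:
  fixes f :: "'a::euclidean_space \<Rightarrow> real \<Rightarrow> real"
  assumes "\<And>b. b \<in> Basis \<Longrightarrow> has_bochner_integral lborel (f b) (c b)"
  shows "has_bochner_integral lborel (\<lambda>x. \<Prod>b\<in>Basis. f b (x \<bullet> b)) (\<Prod>b\<in>Basis. c b)"
proof -
  interpret product_sigma_finite "\<lambda>_::'a. lborel :: real measure"
    by standard
  have meas [measurable]: "f b \<in> borel_measurable borel" if "b \<in> Basis" for b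
    using assms[OF that] by (auto simp: has_bochner_integral_iff)
  have int: "integrable lborel (f b)" and val: "integral\<^sup>L lborel (f b) = c b" if "b \<in> Basis" for b
    using assms[OF that] by (auto simp: has_bochner_integral_iff)
  have "has_bochner_integral (\<Pi>\<^sub>M b\<in>(Basis::'a set). lborel) (\<lambda>x. \<Prod>b\<in>Basis. f b (x b)) (\<Prod>b\<in>Basis. c b)"
    by (simp add: has_bochner_integral_iff product_integrable_prod product_integral_prod int val)
  then show ?thesis
    by (subst lborel_eq, intro has_bochner_integral_distr) (auto simp: inner_sum_left_Basis)
qed

text \<open>A common form for the scalar and the vector law: \<open>DIM('a)\<close> is the real
  dimension, 2 for \<open>complex\<close> and \<open>2 * CARD('t)\<close> for noise vectors.\<close>

definition iso_gaussian :: "real \<Rightarrow> 'a::euclidean_space measure" where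
  "iso_gaussian v = density lborel (\<lambda>x. ennreal (exp (- (norm x)\<^sup>2 / v) / sqrt (pi * v) ^ DIM('a)))"

lemma complex_normal_eq_iso_gaussian: "v > 0 \<Longrightarrow> complex_normal v = iso_gaussian v"
  by (simp add: complex_normal_def iso_gaussian_def)

lemma complex_normal_vec_eq_iso_gaussian:
  assumes "v > 0"
  shows "(complex_normal_vec v :: (complex ^ 't::finite) measure) = iso_gaussian v"
proof -
  have "sqrt (pi * v) ^ (2 * n) = (pi * v) ^ n" for n
    using assms by (simp add: power_mult)
  then show ?thesis
    by (simp add: complex_normal_vec_def iso_gaussian_def mult.commute)
qed

text \<open>The squared norm is a sum of squared coordinates, so the exponential factors. Each
  coordinate has variance \<open>v / 2\<close> because \<open>t^2 / v\<close> equals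
  \<open>t^2 / (2 * (v / 2))\<close>.\<close>

lemma iso_gaussian_density_eq_prod:
  fixes x :: "'a::euclidean_space"
  assumes "v > 0"
  shows "exp (- (norm x)\<^sup>2 / v) / sqrt (pi * v) ^ DIM('a)
    = (\<Prod>b\<in>Basis. normal_density 0 (sqrt (v / 2)) (x \<bullet> b))"
proof -
  have "(norm x)\<^sup>2 = (\<Sum>b\<in>Basis. (x \<bullet> b)\<^sup>2)"
    unfolding power2_norm_eq_inner euclidean_inner[of x x] by (simp add: power2_eq_square)
  then have "exp (- (norm x)\<^sup>2 / v) = (\<Prod>b\<in>Basis. exp (- (x \<bullet> b)\<^sup>2 / v))"
    by (simp add: exp_sum[symmetric] sum_divide_distrib sum_negf)
  then show ?thesis
    using assms by (simp add: normal_density_def prod_dividef)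
qed

lemma has_bochner_integral_iso_gaussian_prod:
  fixes f :: "'a::euclidean_space \<Rightarrow> real \<Rightarrow> real"
  assumes v: "v > 0"
    and [measurable]: "\<And>b. b \<in> Basis \<Longrightarrow> f b \<in> borel_measurable borel"
    and "\<And>b. b \<in> Basis \<Longrightarrow>
      has_bochner_integral lborel (\<lambda>x. normal_density 0 (sqrt (v / 2)) x * f b x) (c b)"
  shows "has_bochner_integral (iso_gaussian v) (\<lambda>x. \<Prod>b\<in>Basis. f b (x \<bullet> b)) (\<Prod>b\<in>Basis. c b)"
  unfolding iso_gaussian_def iso_gaussian_density_eq_prod[OF v]
proof (rule has_bochner_integral_density)
  show "has_bochner_integral lborel (\<lambda>x. (\<Prod>b\<in>Basis. normal_density 0 (sqrt (v / 2)) (x \<bullet> b)) *\<^sub>R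
      (\<Prod>b\<in>Basis. f b (x \<bullet> b))) (prod c Basis)"
    using has_bochner_integral_lborel_prod[OF assms(3)] by (simp add: prod.distrib)
qed (auto intro!: prod_nonneg)

text \<open>Moments of the real normal law of variance \<open>v / 2\<close>, the law of each real coordinate of
  \<^const>\<open>iso_gaussian\<close> with parameter \<open>v\<close>.\<close>
fun normal_moment :: "real \<Rightarrow> nat \<Rightarrow> real" where
  "normal_moment v 0 = 1"
| "normal_moment v (Suc 0) = 0"
| "normal_moment v (Suc (Suc n)) = real (Suc n) * (v / 2) * normal_moment v n"

lemma normal_moment_numeral [simp]:
  "normal_moment v 2 = v / 2" "normal_moment v 3 = 0" "normal_moment v 4 = 3 / 4 * v\<^sup>2"
  by (simp_all add: numeral_eq_Suc power2_eq_square)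

lemma normal_moment_odd_eq_0: "normal_moment v (2 * k + 1) = 0"
  by (induction k) auto

text \<open>Brings the recursive moments into the closed form of the library formula
  \<open>normal_moment_even\<close>, where the base of the power is 2 divided by the variance
  \<open>v / 2\<close>, hence \<open>4 / v\<close>.\<close>

lemma normal_moment_even_eq: "normal_moment v (2 * k) = fact (2 * k) / ((4 / v) ^ k * fact k)"
proof -
  \<comment> \<open>Clearing denominators keeps the induction polynomial: the moment gains the
    factor \<open>(2 * k + 1) * v / 2\<close> and \<open>4 ^ k * fact k\<close> gains
    \<open>4 * (k + 1)\<close>.\<close>
  have "normal_moment v (2 * k) * (4 ^ k * fact k) = fact (2 * k) * v ^ k"
  proof (induction k)
    case (Suc k)
    have "normal_moment v (2 * Suc k) * (4 ^ Suc k * fact (Suc k))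
        = real (2 * k + 2) * real (2 * k + 1) * v * (normal_moment v (2 * k) * (4 ^ k * fact k))"
      by (simp add: algebra_simps)
    also have "\<dots> = fact (2 * Suc k) * v ^ Suc k"
      unfolding Suc.IH by (simp add: algebra_simps)
    finally show ?case .
  qed simp
  then have "normal_moment v (2 * k) = fact (2 * k) * v ^ k / (4 ^ k * fact k)"
    by (simp add: nonzero_eq_divide_eq)
  then show ?thesis
    by (simp add: power_divide)
qed

lemma has_bochner_integral_normal_moment:
  assumes "v > 0"
  shows "has_bochner_integral lborel (\<lambda>x. normal_density 0 (sqrt (v / 2)) x * x ^ k) (normal_moment v k)"
proof (cases "even k")
  case True
  then obtain j where "k = 2 * j" by (elim evenE)
  then show ?thesis
    using normal_moment_even[of "sqrt (v / 2)" 0 j] assms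
    by (simp add: normal_moment_even_eq)
next
  case False
  then obtain j where "k = 2 * j + 1" by (elim oddE)
  then show ?thesis
    using normal_moment_odd[of "sqrt (v / 2)" 0 j] assms normal_moment_odd_eq_0
    by simp
qed

text \<open>Real and imaginary part are the coordinates along 1 and the imaginary unit, over which
  the Gaussian density factors.\<close>

lemma has_bochner_integral_complex_normal_moment:
  assumes "v > 0"
  shows "has_bochner_integral (complex_normal v) (\<lambda>z. Re z ^ i * Im z ^ j)
    (normal_moment v i * normal_moment v j)"
proof -
  have "has_bochner_integral (iso_gaussian v)
      (\<lambda>z::complex. \<Prod>b\<in>Basis. (z \<bullet> b) ^ (if b = 1 then i else j))
      (\<Prod>b\<in>(Basis::complex set). normal_moment v (if b = 1 then i else j))"
    by (rule has_bochner_integral_iso_gaussian_prod[OF assms _ has_bochner_integral_normal_moment[OF assms]])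
       auto
  then show ?thesis
    using assms by (simp add: complex_normal_eq_iso_gaussian Basis_complex_def inner_complex_def)
qed

section \<open>Linear functionals of isotropic Gaussian vectors\<close>

lemma has_bochner_integral_iso_gaussian_inner:
  fixes p :: "'a::euclidean_space"
  assumes v: "v > 0"
  shows "has_bochner_integral (iso_gaussian v) (\<lambda>x. x \<bullet> p) 0"
proof -
  \<comment> \<open>A coordinate is the product with exponent 1 at \<open>b\<close> and 0 elsewhere,
    and the factor at \<open>b\<close> is the vanishing first moment. General \<open>p\<close>
    follows by linearity.\<close>
  have coord: "has_bochner_integral (iso_gaussian v) (\<lambda>x::'a. x \<bullet> b) 0" if "b \<in> Basis" for b
  proof -
    have "has_bochner_integral (iso_gaussian v)
        (\<lambda>x::'a. \<Prod>c\<in>Basis. (x \<bullet> c) ^ (if c = b then 1 else 0))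
        (\<Prod>c\<in>(Basis::'a set). normal_moment v (if c = b then 1 else 0))"
      by (rule has_bochner_integral_iso_gaussian_prod[OF v _ has_bochner_integral_normal_moment[OF v]])
         auto
    moreover have "(\<Prod>c\<in>(Basis::'a set). normal_moment v (if c = b then 1 else 0)) = 0"
      using that by (intro prod_zero) auto
    moreover have "(\<Prod>c\<in>Basis. (x \<bullet> c) ^ (if c = b then 1 else 0)) = x \<bullet> b" for x :: 'a
      using that by (simp add: prod.remove[of _ b])
    ultimately show ?thesis by simp
  qed
  have "has_bochner_integral (iso_gaussian v) (\<lambda>x::'a. \<Sum>b\<in>Basis. (x \<bullet> b) * (p \<bullet> b)) (\<Sum>b\<in>(Basis::'a set). 0 * (p \<bullet> b))"
    by (intro has_bochner_integral_sum has_bochner_integral_mult_left coord)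
  then show ?thesis by (simp add: euclidean_inner[symmetric])
qed

text \<open>Distinct coordinates are uncorrelated with variance \<open>v / 2\<close> each, so the
  double sum over the coordinates of \<open>p\<close> collapses to its diagonal.\<close>

lemma has_bochner_integral_iso_gaussian_inner_square:
  fixes p :: "'a::euclidean_space"
  assumes v: "v > 0"
  shows "has_bochner_integral (iso_gaussian v) (\<lambda>x. (x \<bullet> p)\<^sup>2) (v / 2 * (norm p)\<^sup>2)"
proof -
  have coord: "has_bochner_integral (iso_gaussian v) (\<lambda>x::'a. (x \<bullet> b) * (x \<bullet> c)) (if b = c then v / 2 else 0)"
    if bc: "b \<in> Basis" "c \<in> Basis" for b c
  proof -
    \<comment> \<open>The exponent is 2 at \<open>b\<close> when \<open>b = c\<close>, and otherwise
      1 at each of \<open>b\<close> and \<open>c\<close>, so one product formula yields both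
      variances and covariances.\<close>
    define e where "e d = (if d = b then 1 else 0) + (if d = c then 1 else 0 :: nat)" for d
    have "has_bochner_integral (iso_gaussian v)
        (\<lambda>x::'a. \<Prod>d\<in>Basis. (x \<bullet> d) ^ e d) (\<Prod>d\<in>(Basis::'a set). normal_moment v (e d))"
      by (rule has_bochner_integral_iso_gaussian_prod[OF v _ has_bochner_integral_normal_moment[OF v]])
         auto
    moreover have "(\<Prod>d\<in>(Basis::'a set). normal_moment v (e d)) = (if b = c then v / 2 else 0)"
    proof (cases "b = c")
      case True
      then show ?thesis
        using bc by (simp add: e_def prod.remove[of _ c] numeral_2_eq_2)
    next
      case False
      then have "normal_moment v (e b) = 0" by (simp add: e_def)
      with False show ?thesis
        using bc by (auto intro!: prod_zero bexI[of _ b])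
    qed
    moreover have "(\<Prod>d\<in>Basis. (x \<bullet> d) ^ e d) = (x \<bullet> b) * (x \<bullet> c)" for x :: 'a
      using bc by (simp add: e_def power_add prod.distrib prod.remove[of _ b] prod.remove[of _ c])
    ultimately show ?thesis by simp
  qed
  have "has_bochner_integral (iso_gaussian v)
      (\<lambda>x::'a. \<Sum>b\<in>Basis. \<Sum>c\<in>Basis. ((x \<bullet> b) * (x \<bullet> c)) * ((p \<bullet> b) * (p \<bullet> c)))
      (\<Sum>b\<in>(Basis::'a set). \<Sum>c\<in>Basis. (if b = c then v / 2 else 0) * ((p \<bullet> b) * (p \<bullet> c)))"
    by (intro has_bochner_integral_sum has_bochner_integral_mult_left coord)
  moreover have "(\<Sum>b\<in>Basis. \<Sum>c\<in>Basis. ((x \<bullet> b) * (x \<bullet> c)) * ((p \<bullet> b) * (p \<bullet> c))) = (x \<bullet> p)\<^sup>2"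
    for x :: 'a
    unfolding euclidean_inner[of x p] power2_eq_square
    by (simp add: sum_product mult_ac)
  moreover have "(\<Sum>b\<in>(Basis::'a set). \<Sum>c\<in>Basis. (if b = c then v / 2 else 0) * ((p \<bullet> b) * (p \<bullet> c)))
      = v / 2 * (norm p)\<^sup>2"
    unfolding power2_norm_eq_inner euclidean_inner[of p p]
    by (simp add: if_distrib[of "\<lambda>t. t * _"] sum_distrib_left cong: if_cong)
  ultimately show ?thesis by simp
qed

text \<open>Splits a complex linear functional into two real ones, to which the real Gaussian
  formulas apply.\<close>

lemma herm_inner_eq_inner:
  "herm_inner x y = Complex (y \<bullet> x) (y \<bullet> (\<i> *s x))"
  by (simp add: herm_inner_def inner_vec_def inner_complex_def complex_eq_iff Re_sum Im_sum algebra_simps)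

lemma norm_imaginary_unit_scale: "norm (\<i> *s x) = norm (x :: complex ^ 't::finite)"
  by (simp add: norm_vec_def norm_mult)

text \<open>Real and imaginary part are real functionals along \<open>p\<close> and
  \<open>\<i> *s p\<close>, which have equal norm; each contributes half of the second
  moment.\<close>

lemma has_bochner_integral_complex_normal_vec_herm_inner:
  fixes p :: "complex ^ 't::finite"
  assumes v: "v > 0"
  shows "has_bochner_integral (complex_normal_vec v) (herm_inner p) 0"
    and "has_bochner_integral (complex_normal_vec v) (\<lambda>x. (cmod (herm_inner p x))\<^sup>2) (v * (norm p)\<^sup>2)"
proof -
  have "has_bochner_integral (iso_gaussian v)
      (\<lambda>x. complex_of_real (x \<bullet> p) + \<i> * complex_of_real (x \<bullet> (\<i> *s p)))
      (complex_of_real 0 + \<i> * complex_of_real 0)"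
    by (intro has_bochner_integral_add has_bochner_integral_mult_right has_bochner_integral_of_real
        has_bochner_integral_iso_gaussian_inner v)
  moreover have "complex_of_real (x \<bullet> p) + \<i> * complex_of_real (x \<bullet> (\<i> *s p)) = herm_inner p x" for x
    by (simp add: herm_inner_eq_inner complex_eq_iff)
  ultimately show "has_bochner_integral (complex_normal_vec v) (herm_inner p) 0"
    by (simp add: complex_normal_vec_eq_iso_gaussian[OF v])
  have "has_bochner_integral (iso_gaussian v)
      (\<lambda>x. (x \<bullet> p)\<^sup>2 + (x \<bullet> (\<i> *s p))\<^sup>2) (v / 2 * (norm p)\<^sup>2 + v / 2 * (norm (\<i> *s p))\<^sup>2)"
    by (intro has_bochner_integral_add has_bochner_integral_iso_gaussian_inner_square v)
  then show "has_bochner_integral (complex_normal_vec v) (\<lambda>x. (cmod (herm_inner p x))\<^sup>2) (v * (norm p)\<^sup>2)"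
    by (simp add: complex_normal_vec_eq_iso_gaussian[OF v] herm_inner_eq_inner cmod_power2
        norm_imaginary_unit_scale)
qed

section \<open>Rician channels\<close>

lemma integral_uniform_phase:
  "(\<integral>x. cos x \<partial>uniform_measure lborel {-pi..pi}) = 0"
  "(\<integral>x. sin x \<partial>uniform_measure lborel {-pi..pi}) = 0"
proof -
  \<comment> \<open>The interval has length \<open>2 * pi\<close>; with an explicit real density,
    the fundamental theorem of calculus gives both integrals over the full period.\<close>
  have u: "uniform_measure lborel {-pi..pi} = density lborel (\<lambda>x. ennreal (indicator {-pi..pi} x / (2 * pi)))"
    unfolding uniform_measure_def
  proof (rule density_cong)
    show "AE x in lborel. (indicator {-pi..pi} x / emeasure lborel {-pi..pi} :: ennreal)
        = ennreal (indicator {-pi..pi} x / (2 * pi))"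
      by (auto simp: divide_ennreal[symmetric] split: split_indicator)
  qed auto
  have dens: "(\<integral>x. f x \<partial>uniform_measure lborel {-pi..pi}) = (\<integral>x. f x * indicator {-pi..pi} x \<partial>lborel) / (2 * pi)"
    if [measurable]: "f \<in> borel_measurable borel" for f :: "real \<Rightarrow> real"
    unfolding u by (subst integral_density) (auto simp: mult_ac)
  have "(\<integral>x. cos x * indicator {-pi..pi} x \<partial>lborel) = sin pi - sin (-pi)"
    by (rule integral_FTC_Icc_real) (auto intro!: derivative_eq_intros)
  then show "(\<integral>x. cos x \<partial>uniform_measure lborel {-pi..pi}) = 0"
    by (simp add: dens)
  have "(\<integral>x. sin x * indicator {-pi..pi} x \<partial>lborel) = - cos pi - (- cos (-pi))"
    by (rule integral_FTC_Icc_real) (auto intro!: derivative_eq_intros)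
  then show "(\<integral>x. sin x \<partial>uniform_measure lborel {-pi..pi}) = 0"
    by (simp add: dens)
qed

lemma has_bochner_integral_has_law:
  fixes f :: "'a::topological_space \<Rightarrow> 'b::{banach, second_countable_topology}"
  assumes "has_law P X \<mu>" "has_bochner_integral \<mu> f c" "f \<in> borel_measurable borel"
  shows "has_bochner_integral P (\<lambda>\<omega>. f (X \<omega>)) c"
  using assms unfolding has_law_def has_bochner_integral_iff
  by (metis integrable_distr_eq integral_distr)

context prob_space
begin

lemma has_bochner_integral_mult_indep:
  fixes f :: "'b \<Rightarrow> real" and g :: "'b \<Rightarrow> real"
  assumes "indep_var N X L Y" "f \<in> borel_measurable N" "g \<in> borel_measurable L"
    and "has_bochner_integral M (\<lambda>\<omega>. f (X \<omega>)) a" "has_bochner_integral M (\<lambda>\<omega>. g (Y \<omega>)) b"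
  shows "has_bochner_integral M (\<lambda>\<omega>. f (X \<omega>) * g (Y \<omega>)) (a * b)"
proof -
  have "indep_var borel (\<lambda>\<omega>. f (X \<omega>)) borel (\<lambda>\<omega>. g (Y \<omega>))"
    using indep_var_compose[OF assms(1-3)] by (simp add: comp_def)
  then show ?thesis
    using assms(4,5) indep_var_lebesgue_integral indep_var_integrable
    by (auto simp: has_bochner_integral_iff)
qed

text \<open>Each moment expands into terms that are a bounded function of the phase times a monomial
  in the real and imaginary part of the scatter. Independence splits their expectations, and terms
  linear in cosine or sine, or odd in a scatter component, vanish. The phase is embedded in
  \<open>complex\<close> because \<open>indep_var\<close> asks for one value type.\<close>

lemma rician_moments:
  fixes a v :: real
  assumes phase: "has_law M \<phi> (uniform_measure lborel {-pi..pi})"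
    and scatter: "has_law M G (complex_normal v)" and v: "v > 0"
    and indep: "indep_var borel (\<lambda>\<omega>. complex_of_real (\<phi> \<omega>)) borel G"
  defines "H \<equiv> \<lambda>\<omega>. complex_of_real a * exp (\<i> * complex_of_real (\<phi> \<omega>)) + G \<omega>"
  shows "has_bochner_integral M H 0"
    and "has_bochner_integral M (\<lambda>\<omega>. (cmod (H \<omega>))\<^sup>2) (v + a\<^sup>2)"
    and "has_bochner_integral M (\<lambda>\<omega>. cmod (H \<omega>) ^ 4) ((v + a\<^sup>2)\<^sup>2 + (v\<^sup>2 + 2 * a\<^sup>2 * v))"
proof -
  have [measurable]: "\<phi> \<in> borel_measurable M" "G \<in> borel_measurable M"
    using phase scatter by (auto simp: has_law_def)
  define c s x y where "c = (\<lambda>\<omega>. cos (\<phi> \<omega>))" and "s = (\<lambda>\<omega>. sin (\<phi> \<omega>))"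
    and "x = (\<lambda>\<omega>. Re (G \<omega>))" and "y = (\<lambda>\<omega>. Im (G \<omega>))"
  have cs1: "(c \<omega>)\<^sup>2 + (s \<omega>)\<^sup>2 = 1" for \<omega>
    by (simp add: c_def s_def)
  have phase_int: "has_bochner_integral M (\<lambda>\<omega>. f (\<phi> \<omega>)) (expectation (\<lambda>\<omega>. f (\<phi> \<omega>)))"
    if "f \<in> borel_measurable borel" "\<And>t. \<bar>f t\<bar> \<le> 1" for f :: "real \<Rightarrow> real"
    using that by (auto simp: has_bochner_integral_iff intro!: integrable_const_bound[of _ 1])
  have Ec: "expectation c = 0" and Es: "expectation s = 0"
  proof -
    have "expectation (\<lambda>\<omega>. f (\<phi> \<omega>)) = (\<integral>t. f t \<partial>uniform_measure lborel {-pi..pi})"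
      if "f \<in> borel_measurable borel" for f :: "real \<Rightarrow> real"
      using phase that unfolding has_law_def by (metis \<open>\<phi> \<in> borel_measurable M\<close> integral_distr)
    then show "expectation c = 0" "expectation s = 0"
      by (simp_all add: c_def s_def integral_uniform_phase)
  qed
  \<comment> \<open>All terms of the expansions are instances of this one; the bound 1 on the
    trigonometric factor supplies its integrability.\<close>
  have mon: "has_bochner_integral M (\<lambda>\<omega>. f (\<phi> \<omega>) * (x \<omega> ^ i * y \<omega> ^ j))
      (expectation (\<lambda>\<omega>. f (\<phi> \<omega>)) * (normal_moment v i * normal_moment v j))"
    if "f \<in> borel_measurable borel" "\<And>t. \<bar>f t\<bar> \<le> 1" for f :: "real \<Rightarrow> real" and i j
    unfolding x_def y_def
    using has_bochner_integral_mult_indep[OF indep, where f = "\<lambda>z. f (Re z)" and g = "\<lambda>z. Re z ^ i * Im z ^ j",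
        simplified, OF _ phase_int has_bochner_integral_has_law[OF scatter
          has_bochner_integral_complex_normal_moment[OF v]]] that
    by simp
  have pure: "has_bochner_integral M (\<lambda>\<omega>. x \<omega> ^ i * y \<omega> ^ j) (normal_moment v i * normal_moment v j)" for i j
    using mon[of "\<lambda>_. 1" i j] by (simp add: prob_space)
  have mon_c: "has_bochner_integral M (\<lambda>\<omega>. c \<omega> * (x \<omega> ^ i * y \<omega> ^ j)) 0" for i j
    using mon[of cos i j] Ec by (simp add: c_def)
  have mon_s: "has_bochner_integral M (\<lambda>\<omega>. s \<omega> * (x \<omega> ^ i * y \<omega> ^ j)) 0" for i j
    using mon[of sin i j] Es by (simp add: s_def)
  \<comment> \<open>The expectation of \<open>c * s\<close> is left uncomputed: the factor
    contributed by \<open>x * y\<close> is already zero.\<close>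
  have mon_cs: "has_bochner_integral M (\<lambda>\<omega>. (c \<omega> * s \<omega>) * (x \<omega> ^ 1 * y \<omega> ^ 1)) 0"
  proof -
    have "\<bar>cos t * sin t\<bar> \<le> 1" for t :: real
      using mult_mono[of "\<bar>cos t\<bar>" 1 "\<bar>sin t\<bar>" 1] by (simp add: abs_mult)
    from mon[of "\<lambda>t. cos t * sin t" 1 1, OF _ this] show ?thesis
      by (simp add: c_def s_def)
  qed
  \<comment> \<open>The values of \<open>C\<close> and \<open>S\<close> stay unknown. Since
    \<open>x\<close> and \<open>y\<close> have equal variance, only \<open>C + S\<close> enters the
    fourth moment, and it is 1 by \<open>cs1\<close>.\<close>
  define C where "C = expectation (\<lambda>\<omega>. (c \<omega>)\<^sup>2)"
  define S where "S = expectation (\<lambda>\<omega>. (s \<omega>)\<^sup>2)"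
  have sq_le: "\<bar>(cos t)\<^sup>2\<bar> \<le> 1" "\<bar>(sin t)\<^sup>2\<bar> \<le> 1" for t :: real
    by (simp_all add: abs_square_le_1)
  have mon_c2: "has_bochner_integral M (\<lambda>\<omega>. (c \<omega>)\<^sup>2 * (x \<omega> ^ i * y \<omega> ^ j)) (C * (normal_moment v i * normal_moment v j))" for i j
    using mon[of "\<lambda>t. (cos t)\<^sup>2" i j] sq_le by (simp add: c_def C_def)
  have mon_s2: "has_bochner_integral M (\<lambda>\<omega>. (s \<omega>)\<^sup>2 * (x \<omega> ^ i * y \<omega> ^ j)) (S * (normal_moment v i * normal_moment v j))" for i j
    using mon[of "\<lambda>t. (sin t)\<^sup>2" i j] sq_le by (simp add: s_def S_def)
  have CS: "C + S = 1"
  proof -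
    have "has_bochner_integral M (\<lambda>\<omega>. (c \<omega>)\<^sup>2 * (x \<omega> ^ 0 * y \<omega> ^ 0) + (s \<omega>)\<^sup>2 * (x \<omega> ^ 0 * y \<omega> ^ 0))
      (C * (normal_moment v 0 * normal_moment v 0) + S * (normal_moment v 0 * normal_moment v 0))"
      by (intro has_bochner_integral_add mon_c2 mon_s2)
    then have "has_bochner_integral M (\<lambda>\<omega>. 1) (C + S)"
      by (simp add: cs1)
    then show ?thesis
      by (simp add: has_bochner_integral_iff prob_space)
  qed
  have H: "H \<omega> = Complex (a * c \<omega> + x \<omega>) (a * s \<omega> + y \<omega>)" for \<omega>
    by (simp add: H_def c_def s_def x_def y_def complex_eq_iff Re_exp Im_exp)
  have H2: "(cmod (H \<omega>))\<^sup>2 = a\<^sup>2 + 2 * a * (c \<omega> * x \<omega> + s \<omega> * y \<omega>) + (x \<omega>)\<^sup>2 + (y \<omega>)\<^sup>2" for \<omega>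
    unfolding H cmod_power2 using cs1[of \<omega>] by simp algebra

  \<comment> \<open>Zeroth powers are written out so that every summand matches
    \<open>mon_c\<close>, \<open>mon_s\<close> or \<open>pure\<close> literally.\<close>
  have "has_bochner_integral M (\<lambda>\<omega>.
      complex_of_real (a * (c \<omega> * (x \<omega> ^ 0 * y \<omega> ^ 0)) + x \<omega> ^ 1 * y \<omega> ^ 0)
      + \<i> * complex_of_real (a * (s \<omega> * (x \<omega> ^ 0 * y \<omega> ^ 0)) + x \<omega> ^ 0 * y \<omega> ^ 1))
      (complex_of_real (a * 0 + normal_moment v 1 * normal_moment v 0)
      + \<i> * complex_of_real (a * 0 + normal_moment v 0 * normal_moment v 1))"
    by (intro has_bochner_integral_add has_bochner_integral_mult_right has_bochner_integral_of_real
        mon_c mon_s pure)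
  also have "(\<lambda>\<omega>. complex_of_real (a * (c \<omega> * (x \<omega> ^ 0 * y \<omega> ^ 0)) + x \<omega> ^ 1 * y \<omega> ^ 0)
      + \<i> * complex_of_real (a * (s \<omega> * (x \<omega> ^ 0 * y \<omega> ^ 0)) + x \<omega> ^ 0 * y \<omega> ^ 1)) = H"
    by (auto simp: H complex_eq_iff)
  finally show "has_bochner_integral M H 0" by simp

  have "has_bochner_integral M (\<lambda>\<omega>. a\<^sup>2 * (x \<omega> ^ 0 * y \<omega> ^ 0)
      + 2 * a * (c \<omega> * (x \<omega> ^ 1 * y \<omega> ^ 0) + s \<omega> * (x \<omega> ^ 0 * y \<omega> ^ 1))
      + x \<omega> ^ 2 * y \<omega> ^ 0 + x \<omega> ^ 0 * y \<omega> ^ 2)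
      (a\<^sup>2 * (normal_moment v 0 * normal_moment v 0) + 2 * a * (0 + 0)
       + normal_moment v 2 * normal_moment v 0 + normal_moment v 0 * normal_moment v 2)"
    by (intro has_bochner_integral_add has_bochner_integral_mult_right mon_c mon_s pure)
  then show "has_bochner_integral M (\<lambda>\<omega>. (cmod (H \<omega>))\<^sup>2) (v + a\<^sup>2)"
    by (simp add: H2 algebra_simps)

  \<comment> \<open>With \<open>u = c * x + s * y\<close> and \<open>r = x^2 + y^2\<close> this is
    the square of \<open>a^2 + 2 * a * u + r\<close>, sorted as \<open>a^4\<close>,
    \<open>4 * a^2 * u^2\<close>, \<open>r^2\<close>, \<open>4 * a^3 * u\<close>,
    \<open>2 * a^2 * r\<close>, \<open>4 * a * u * r\<close>.\<close>
  have H4: "cmod (H \<omega>) ^ 4 = a ^ 4 * (x \<omega> ^ 0 * y \<omega> ^ 0)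
      + 4 * a\<^sup>2 * ((c \<omega>)\<^sup>2 * (x \<omega> ^ 2 * y \<omega> ^ 0) + 2 * ((c \<omega> * s \<omega>) * (x \<omega> ^ 1 * y \<omega> ^ 1))
          + (s \<omega>)\<^sup>2 * (x \<omega> ^ 0 * y \<omega> ^ 2))
      + (x \<omega> ^ 4 * y \<omega> ^ 0 + 2 * (x \<omega> ^ 2 * y \<omega> ^ 2) + x \<omega> ^ 0 * y \<omega> ^ 4)
      + 4 * a ^ 3 * (c \<omega> * (x \<omega> ^ 1 * y \<omega> ^ 0) + s \<omega> * (x \<omega> ^ 0 * y \<omega> ^ 1))
      + 2 * a\<^sup>2 * (x \<omega> ^ 2 * y \<omega> ^ 0 + x \<omega> ^ 0 * y \<omega> ^ 2)
      + 4 * a * (c \<omega> * (x \<omega> ^ 3 * y \<omega> ^ 0) + c \<omega> * (x \<omega> ^ 1 * y \<omega> ^ 2)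
          + s \<omega> * (x \<omega> ^ 2 * y \<omega> ^ 1) + s \<omega> * (x \<omega> ^ 0 * y \<omega> ^ 3))" for \<omega>
  proof -
    have "cmod (H \<omega>) ^ 4 = ((cmod (H \<omega>))\<^sup>2)\<^sup>2"
      by (simp flip: power_mult)
    then show ?thesis
      unfolding H2 by (simp add: algebra_simps power2_eq_square power3_eq_cube power4_eq_xxxx)
  qed
  have "has_bochner_integral M (\<lambda>\<omega>. cmod (H \<omega>) ^ 4)
     (a ^ 4 * (normal_moment v 0 * normal_moment v 0)
      + 4 * a\<^sup>2 * (C * (normal_moment v 2 * normal_moment v 0) + 2 * 0
          + S * (normal_moment v 0 * normal_moment v 2))
      + (normal_moment v 4 * normal_moment v 0 + 2 * (normal_moment v 2 * normal_moment v 2)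
          + normal_moment v 0 * normal_moment v 4)
      + 4 * a ^ 3 * (0 + 0)
      + 2 * a\<^sup>2 * (normal_moment v 2 * normal_moment v 0 + normal_moment v 0 * normal_moment v 2)
      + 4 * a * (0 + 0 + 0 + 0))" (is "has_bochner_integral M _ ?V")
    unfolding H4
    by (intro has_bochner_integral_add has_bochner_integral_mult_right mon_c mon_s mon_c2 mon_s2 mon_cs pure)
  \<comment> \<open>The total is \<open>a^4 + 4 * a^2 * v + 2 * v^2\<close>; the target form
    separates off the squared second moment.\<close>
  moreover have "?V = (v + a\<^sup>2)\<^sup>2 + (v\<^sup>2 + 2 * a\<^sup>2 * v)"
  proof -
    have "?V = a ^ 4 + 2 * a\<^sup>2 * v * (C + S) + 2 * v\<^sup>2 + 2 * a\<^sup>2 * v"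
      by (simp add: algebra_simps power2_eq_square)
    then show ?thesis
      by (simp add: CS algebra_simps power2_eq_square power4_eq_xxxx)
  qed
  ultimately show "has_bochner_integral M (\<lambda>\<omega>. cmod (H \<omega>) ^ 4) ((v + a\<^sup>2)\<^sup>2 + (v\<^sup>2 + 2 * a\<^sup>2 * v))"
    by (simp only:)
qed

end

section \<open>Sums of independent zero-mean variables\<close>

context prob_space
begin

text \<open>A lower power is at most 1 plus the higher one, and constants are integrable on a
  probability space. This supplies third moments from fourth moments.\<close>

lemma integrable_norm_power_mono:
  fixes X :: "'a \<Rightarrow> 'b::{banach, second_countable_topology}"
  assumes [measurable]: "X \<in> borel_measurable M" and "integrable M (\<lambda>\<omega>. norm (X \<omega>) ^ n)" "m \<le> n"
  shows "integrable M (\<lambda>\<omega>. norm (X \<omega>) ^ m)"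
proof (rule Bochner_Integration.integrable_bound)
  show "integrable M (\<lambda>\<omega>. 1 + norm (X \<omega>) ^ n)"
    using assms(2) by simp
  show "AE \<omega> in M. norm (norm (X \<omega>) ^ m) \<le> norm (1 + norm (X \<omega>) ^ n)"
  proof (rule AE_I2)
    fix \<omega>
    have "norm (X \<omega>) ^ m \<le> 1 + norm (X \<omega>) ^ n"
    proof (cases "norm (X \<omega>) \<le> 1")
      case True
      then show ?thesis by (simp add: power_le_one add_increasing2)
    next
      case False
      then show ?thesis using power_increasing[OF \<open>m \<le> n\<close>, of "norm (X \<omega>)"] by linarith
    qed
    then show "norm (norm (X \<omega>) ^ m) \<le> norm (1 + norm (X \<omega>) ^ n)"
      by simp
  qed
qed simp

lemma indep_vars_disjoint_functions:
  assumes ind: "indep_vars (\<lambda>_. N) X I" and AB: "A \<inter> B = {}" "A \<subseteq> I" "B \<subseteq> I"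
    and f: "f \<in> measurable (PiM A (\<lambda>_. N)) K" and g: "g \<in> measurable (PiM B (\<lambda>_. N)) L"
  shows "indep_var K (\<lambda>\<omega>. f (restrict (\<lambda>i. X i \<omega>) A)) L (\<lambda>\<omega>. g (restrict (\<lambda>i. X i \<omega>) B))"
  using indep_var_compose[OF indep_var_restrict[OF ind AB] f g] by (simp add: comp_def)

text \<open>The two variables depend on the disjoint index blocks \<open>{k}\<close> and
  \<open>B\<close>.\<close>

lemma indep_vars_indep_var_sum:
  fixes X :: "'i::finite \<Rightarrow> 'a \<Rightarrow> complex"
  assumes ind: "indep_vars (\<lambda>_. borel) X UNIV" and "k \<notin> B"
    and "f \<in> borel_measurable borel" "g \<in> borel_measurable borel"
  shows "indep_var borel (\<lambda>\<omega>. f (X k \<omega>)) borel (\<lambda>\<omega>. g (\<Sum>i\<in>B. a i * X i \<omega>))"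
proof -
  have "indep_var borel (\<lambda>\<omega>. (\<lambda>x. f (x k)) (restrict (\<lambda>i. X i \<omega>) {k}))
      borel (\<lambda>\<omega>. (\<lambda>x. g (\<Sum>i\<in>B. a i * x i)) (restrict (\<lambda>i. X i \<omega>) B))"
  proof (rule indep_vars_disjoint_functions[OF ind])
    note [measurable] = assms(3,4)
    show "(\<lambda>x. f (x k)) \<in> borel_measurable (Pi\<^sub>M {k} (\<lambda>_. borel))"
      by measurable
    show "(\<lambda>x. g (\<Sum>i\<in>B. a i * x i)) \<in> borel_measurable (Pi\<^sub>M B (\<lambda>_. borel))"
      by measurable
  qed (use \<open>k \<notin> B\<close> in auto)
  then show ?thesis by simp
qed

text \<open>Distinct \<open>X i\<close> are uncorrelated, which gives the first two identities. For
  the third, \<open>Y\<close> is split as \<open>a k * X k + Z\<close> with \<open>Z\<close>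
  independent of \<open>X k\<close>; the cross term vanishes because \<open>Z\<close> has mean
  zero.\<close>

lemma indep_sum_moments:
  fixes X :: "'i::finite \<Rightarrow> 'a \<Rightarrow> complex" and a :: "'i \<Rightarrow> real"
  assumes ind: "indep_vars (\<lambda>_. borel) X UNIV"
    and mean: "\<And>i. has_bochner_integral M (X i) 0"
    and power: "\<And>i. has_bochner_integral M (\<lambda>\<omega>. (cmod (X i \<omega>))\<^sup>2) (s i)"
  defines "Y \<equiv> \<lambda>\<omega>. \<Sum>i\<in>UNIV. complex_of_real (a i) * X i \<omega>"
  shows "expectation (\<lambda>\<omega>. (cmod (Y \<omega>))\<^sup>2) = (\<Sum>i\<in>UNIV. (a i)\<^sup>2 * s i)"
    and "expectation (\<lambda>\<omega>. cnj (X k \<omega>) * Y \<omega>) = complex_of_real (a k * s k)"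
    and "has_bochner_integral M (\<lambda>\<omega>. cmod (X k \<omega>) ^ 4) q \<Longrightarrow>
      expectation (\<lambda>\<omega>. (cmod (cnj (X k \<omega>) * Y \<omega>))\<^sup>2)
        = s k * (\<Sum>i\<in>UNIV. (a i)\<^sup>2 * s i) + (a k)\<^sup>2 * (q - (s k)\<^sup>2)"
proof -
  have [measurable]: "X i \<in> borel_measurable M" for i
    using ind by (simp add: indep_vars_def)
  have [measurable, simp]: "cnj \<in> borel_measurable borel"
    by (intro borel_measurable_continuous_onI continuous_intros)
  have corr: "has_bochner_integral M (\<lambda>\<omega>. cnj (X i \<omega>) * X j \<omega>) (if i = j then complex_of_real (s i) else 0)"
    for i j
  proof (cases "i = j")
    case True
    then show ?thesis
      using has_bochner_integral_of_real[OF power[of i], where 'a=complex]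
      by (simp add: complex_norm_square mult.commute del: of_real_power)
  next
    case False
    \<comment> \<open>The singleton \<open>{j}\<close> with coefficient 1 turns the statement about
      sums into pairwise independence.\<close>
    have ind2: "indep_var borel (\<lambda>\<omega>. cnj (X i \<omega>)) borel (\<lambda>\<omega>. X j \<omega>)"
    proof -
      have "indep_var borel (\<lambda>\<omega>. cnj (X i \<omega>)) borel (\<lambda>\<omega>. \<Sum>l\<in>{j}. 1 * X l \<omega>)"
        by (rule indep_vars_indep_var_sum[OF ind, where f = cnj and g = "\<lambda>x. x"])
           (use False in simp_all)
      then show ?thesis by simp
    qed
    have int: "integrable M (\<lambda>\<omega>. cnj (X i \<omega>))" "integrable M (X j)" and zero: "expectation (X j) = 0"
      using mean[of i] mean[of j] by (simp_all add: has_bochner_integral_iff)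
    have "expectation (\<lambda>\<omega>. cnj (X i \<omega>) * X j \<omega>) = 0"
      using indep_var_lebesgue_integral[OF ind2 int] zero by simp
    then show ?thesis
      using indep_var_integrable[OF ind2 int] False
      by (simp add: has_bochner_integral_iff)
  qed
  have sum_power: "has_bochner_integral M
      (\<lambda>\<omega>. (cmod (\<Sum>i\<in>B. complex_of_real (a i) * X i \<omega>))\<^sup>2) (\<Sum>i\<in>B. (a i)\<^sup>2 * s i)" for B
  proof -
    \<comment> \<open>The squared modulus becomes a complex double sum of which only the diagonal
      survives; taking real parts at the end returns to the reals.\<close>
    have "has_bochner_integral M
        (\<lambda>\<omega>. \<Sum>i\<in>B. \<Sum>j\<in>B. complex_of_real (a i * a j) * (cnj (X i \<omega>) * X j \<omega>))
        (\<Sum>i\<in>B. \<Sum>j\<in>B. complex_of_real (a i * a j) * (if i = j then complex_of_real (s i) else 0))"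
      by (intro has_bochner_integral_sum has_bochner_integral_mult_right corr)
    also have "(\<lambda>\<omega>. \<Sum>i\<in>B. \<Sum>j\<in>B. complex_of_real (a i * a j) * (cnj (X i \<omega>) * X j \<omega>))
        = (\<lambda>\<omega>. complex_of_real ((cmod (\<Sum>i\<in>B. complex_of_real (a i) * X i \<omega>))\<^sup>2))" (is "?L = ?R")
    proof
      fix \<omega>
      have "?R \<omega> = cnj (\<Sum>i\<in>B. complex_of_real (a i) * X i \<omega>) * (\<Sum>i\<in>B. complex_of_real (a i) * X i \<omega>)"
        by (simp only: complex_norm_square mult.commute)
      also have "\<dots> = ?L \<omega>"
        by (simp only: cnj_sum sum_product) (simp add: mult_ac)
      finally show "?L \<omega> = ?R \<omega>" by simp
    qed
    also have "(\<Sum>i\<in>B. \<Sum>j\<in>B. complex_of_real (a i * a j) * (if i = j then complex_of_real (s i) else 0))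
        = complex_of_real (\<Sum>i\<in>B. (a i)\<^sup>2 * s i)"
      by (simp add: power2_eq_square if_distrib[of "\<lambda>t. _ * t"] cong: if_cong)
    finally show ?thesis
      by (drule_tac has_bochner_integral_Re) (simp only: Re_complex_of_real)
  qed
  show "expectation (\<lambda>\<omega>. (cmod (Y \<omega>))\<^sup>2) = (\<Sum>i\<in>UNIV. (a i)\<^sup>2 * s i)"
    unfolding Y_def using sum_power by (simp add: has_bochner_integral_iff)
  have "has_bochner_integral M
      (\<lambda>\<omega>. \<Sum>i\<in>UNIV. complex_of_real (a i) * (cnj (X k \<omega>) * X i \<omega>))
      (\<Sum>i\<in>UNIV. complex_of_real (a i) * (if k = i then complex_of_real (s k) else 0))"
    by (intro has_bochner_integral_sum has_bochner_integral_mult_right corr)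
  also have "(\<lambda>\<omega>. \<Sum>i\<in>UNIV. complex_of_real (a i) * (cnj (X k \<omega>) * X i \<omega>)) = (\<lambda>\<omega>. cnj (X k \<omega>) * Y \<omega>)"
    by (simp add: Y_def sum_distrib_left mult_ac)
  also have "(\<Sum>i\<in>UNIV. complex_of_real (a i) * (if k = i then complex_of_real (s k) else 0))
      = complex_of_real (a k * s k)"
    by (simp add: if_distrib[of "\<lambda>t. _ * t"] cong: if_cong)
  finally show "expectation (\<lambda>\<omega>. cnj (X k \<omega>) * Y \<omega>) = complex_of_real (a k * s k)"
    by (simp add: has_bochner_integral_iff)

  assume q: "has_bochner_integral M (\<lambda>\<omega>. cmod (X k \<omega>) ^ 4) q"
  define Z where "Z = (\<lambda>\<omega>. \<Sum>i\<in>UNIV - {k}. complex_of_real (a i) * X i \<omega>)"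
  have Y: "Y \<omega> = complex_of_real (a k) * X k \<omega> + Z \<omega>" for \<omega>
    by (simp add: Y_def Z_def sum.remove[of UNIV k])
  have indZ: "indep_var borel (\<lambda>\<omega>. f (X k \<omega>)) borel (\<lambda>\<omega>. g (Z \<omega>))"
    if "f \<in> borel_measurable borel" "g \<in> borel_measurable borel" for f :: "complex \<Rightarrow> 'c::topological_space" and g
    unfolding Z_def by (rule indep_vars_indep_var_sum[OF ind]) (use that in auto)
  have meanZ: "has_bochner_integral M Z 0"
  proof -
    have "has_bochner_integral M Z (\<Sum>i\<in>UNIV - {k}. complex_of_real (a i) * 0)"
      unfolding Z_def by (intro has_bochner_integral_sum has_bochner_integral_mult_right mean)
    then show ?thesis by simp
  qed
  define t where "t = (\<Sum>i\<in>UNIV - {k}. (a i)\<^sup>2 * s i)"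
  have powerZ: "has_bochner_integral M (\<lambda>\<omega>. (cmod (Z \<omega>))\<^sup>2) t"
    unfolding Z_def t_def by (rule sum_power)
  have cross: "has_bochner_integral M (\<lambda>\<omega>. (complex_of_real ((cmod (X k \<omega>))\<^sup>2) * cnj (X k \<omega>)) * Z \<omega>) 0"
  proof -
    have ind3: "indep_var borel (\<lambda>\<omega>. complex_of_real ((cmod (X k \<omega>))\<^sup>2) * cnj (X k \<omega>)) borel Z"
      by (rule indZ[of "\<lambda>x. complex_of_real ((cmod x)\<^sup>2) * cnj x" "\<lambda>x. x"])
         measurable
    \<comment> \<open>The factor of \<open>Z\<close> in the cross term has modulus
      \<open>cmod (X k \<omega>) ^ 3\<close>.\<close>
    have "integrable M (\<lambda>\<omega>. cmod (X k \<omega>) ^ 3)"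
      using q by (rule_tac integrable_norm_power_mono[of _ 4]) (simp_all add: has_bochner_integral_iff)
    then have int: "integrable M (\<lambda>\<omega>. complex_of_real ((cmod (X k \<omega>))\<^sup>2) * cnj (X k \<omega>))"
      by (rule Bochner_Integration.integrable_bound)
         (measurable, simp add: norm_mult norm_power power2_eq_square power3_eq_cube)
    have "integrable M Z" "expectation Z = 0"
      using meanZ by (simp_all add: has_bochner_integral_iff)
    then show ?thesis
      using indep_var_integrable[OF ind3 int] indep_var_lebesgue_integral[OF ind3 int]
      by (simp add: has_bochner_integral_iff del: of_real_power)
  qed
  have sq: "has_bochner_integral M (\<lambda>\<omega>. (cmod (X k \<omega>))\<^sup>2 * (cmod (Z \<omega>))\<^sup>2) (s k * t)"
  proof -
    have ind4: "indep_var borel (\<lambda>\<omega>. (cmod (X k \<omega>))\<^sup>2) borel (\<lambda>\<omega>. (cmod (Z \<omega>))\<^sup>2)"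
      by (rule indZ[of "\<lambda>x. (cmod x)\<^sup>2" "\<lambda>x. (cmod x)\<^sup>2"]) measurable
    then show ?thesis
      using indep_var_integrable[OF ind4] indep_var_lebesgue_integral[OF ind4] power[of k] powerZ
      by (simp add: has_bochner_integral_iff)
  qed
  have expand: "(cmod (cnj (X k \<omega>) * Y \<omega>))\<^sup>2 = (a k)\<^sup>2 * cmod (X k \<omega>) ^ 4
      + 2 * a k * Re ((complex_of_real ((cmod (X k \<omega>))\<^sup>2) * cnj (X k \<omega>)) * Z \<omega>)
      + (cmod (X k \<omega>))\<^sup>2 * (cmod (Z \<omega>))\<^sup>2" for \<omega>
  proof -
    have "(cmod (Y \<omega>))\<^sup>2 = (a k)\<^sup>2 * (cmod (X k \<omega>))\<^sup>2 + 2 * a k * Re (cnj (X k \<omega>) * Z \<omega>) + (cmod (Z \<omega>))\<^sup>2"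
      unfolding Y cmod_power2 by simp algebra
    moreover have "(cmod (cnj (X k \<omega>) * Y \<omega>))\<^sup>2 = (cmod (X k \<omega>))\<^sup>2 * (cmod (Y \<omega>))\<^sup>2"
      by (simp add: norm_mult power_mult_distrib)
    moreover have "Re (complex_of_real r * cnj (X k \<omega>) * Z \<omega>) = r * Re (cnj (X k \<omega>) * Z \<omega>)" for r
      by (simp add: algebra_simps)
    ultimately show ?thesis
      by (simp only:) (simp only: algebra_simps power2_eq_square power4_eq_xxxx)
  qed
  have "has_bochner_integral M (\<lambda>\<omega>. (cmod (cnj (X k \<omega>) * Y \<omega>))\<^sup>2)
      ((a k)\<^sup>2 * q + 2 * a k * Re 0 + s k * t)"
    unfolding expand
    by (intro has_bochner_integral_add has_bochner_integral_mult_right q has_bochner_integral_Re cross sq)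
  \<comment> \<open>Eliminating \<open>t\<close> in favour of the total power leaves
    \<open>q - (s k)\<^sup>2\<close>, the variance of the squared modulus of
    \<open>X k\<close>.\<close>
  moreover have "(\<Sum>i\<in>UNIV. (a i)\<^sup>2 * s i) = (a k)\<^sup>2 * s k + t"
    by (simp add: t_def sum.remove[of UNIV k])
  ultimately show "expectation (\<lambda>\<omega>. (cmod (cnj (X k \<omega>) * Y \<omega>))\<^sup>2)
        = s k * (\<Sum>i\<in>UNIV. (a i)\<^sup>2 * s i) + (a k)\<^sup>2 * (q - (s k)\<^sup>2)"
    by (simp add: has_bochner_integral_iff algebra_simps power2_eq_square)
qed

end

section \<open>Independence of the channels and the pilot noise at one access point\<close>

text \<open>\<open>indep_vars\<close> needs one value type for all variables, so each source is embedded into a product.\<close>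
definition source_value ::
  "('m \<Rightarrow> 'k \<Rightarrow> 'w \<Rightarrow> real) \<Rightarrow> ('m \<Rightarrow> 'k \<Rightarrow> 'w \<Rightarrow> complex) \<Rightarrow> ('m \<Rightarrow> 'w \<Rightarrow> complex ^ 't::finite) \<Rightarrow>
   ('m, 'k) source \<Rightarrow> 'w \<Rightarrow> real \<times> complex \<times> (complex ^ 't)" where
  "source_value phase g nz s \<omega> =
     (case s of
        Phase m k \<Rightarrow> (phase m k \<omega>, 0, 0)
      | Scatter m k \<Rightarrow> (0, g m k \<omega>, 0)
      | Pilot_Noise m \<Rightarrow> (0, 0, nz m \<omega>))"

lemma source_value_simps [simp]:
  "source_value phase g nz (Phase m k) \<omega> = (phase m k \<omega>, 0, 0)"
  "source_value phase g nz (Scatter m k) \<omega> = (0, g m k \<omega>, 0)"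
  "source_value phase g nz (Pilot_Noise m) \<omega> = (0, 0, nz m \<omega>)"
  by (simp_all add: source_value_def)

text \<open>Lets independence pass from the sources to Borel functions of them, since
  \<open>indep_sets\<close> is inherited by smaller families of events.\<close>

lemma var_events_comp_subset:
  assumes "f \<in> borel_measurable borel"
  shows "{(\<lambda>\<omega>. f (X \<omega>)) -` A \<inter> space M | A. A \<in> sets borel} \<subseteq> var_events M X"
proof -
  have "(\<lambda>\<omega>. f (X \<omega>)) -` A \<inter> space M = X -` (f -` A) \<inter> space M" for A
    by auto
  then show ?thesis
    unfolding var_events_def using measurable_sets_borel[OF assms] by blast
qed

context prob_space
begin

text \<open>Padding with zeros is continuous, hence Borel, so the events of a padded source lie in
  the family that \<open>indep_sources\<close> assigns to it.\<close>

lemma indep_vars_source_value: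
  fixes phase :: "'m \<Rightarrow> 'k \<Rightarrow> 'a \<Rightarrow> real" and nz :: "'m \<Rightarrow> 'a \<Rightarrow> complex ^ 't::finite"
  assumes indep: "indep_sources M phase g nz"
    and [measurable]: "\<And>m k. phase m k \<in> borel_measurable M" "\<And>m k. g m k \<in> borel_measurable M"
      "\<And>m. nz m \<in> borel_measurable M"
  shows "indep_vars (\<lambda>_. borel) (source_value phase g nz) UNIV"
  unfolding indep_vars_def2
proof (intro conjI ballI)
  fix s :: "('m, 'k) source"
  show "source_value phase g nz s \<in> borel_measurable M"
    unfolding source_value_def borel_prod[symmetric] by (cases s) simp_all
next
  show "indep_sets (\<lambda>s. {source_value phase g nz s -` A \<inter> space M |A. A \<in> sets borel}) UNIV"
  proof (rule indep_sets_mono_sets[OF indep[unfolded indep_sources_def]])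
    fix s :: "('m, 'k) source"
    have inj: "(\<lambda>x::real. (x, 0::complex, 0::complex ^ 't)) \<in> borel_measurable borel"
      "(\<lambda>x::complex. (0::real, x, 0::complex ^ 't)) \<in> borel_measurable borel"
      "(\<lambda>x::complex ^ 't. (0::real, 0::complex, x)) \<in> borel_measurable borel"
      by (intro borel_measurable_continuous_onI continuous_intros)+
    show "{source_value phase g nz s -` A \<inter> space M |A. A \<in> sets borel}
        \<subseteq> (case s of Phase m k \<Rightarrow> var_events M (phase m k) | Scatter m k \<Rightarrow> var_events M (g m k)
            | Pilot_Noise m \<Rightarrow> var_events M (nz m))"
      using inj[THEN var_events_comp_subset] unfolding source_value_def
      by (cases s) (simp_all only: source.case)
  qed
qed

lemma indep_var_phase_scatter:
  assumes "indep_vars (\<lambda>_. borel) (source_value phase g nz) UNIV"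
  shows "indep_var borel (\<lambda>\<omega>. complex_of_real (phase m k \<omega>)) borel (g m k)"
proof -
  have "indep_var
      borel (\<lambda>\<omega>. (\<lambda>x. complex_of_real (fst (x (Phase m k)))) (restrict (\<lambda>i. source_value phase g nz i \<omega>) {Phase m k}))
      borel (\<lambda>\<omega>. (\<lambda>x. fst (snd (x (Scatter m k)))) (restrict (\<lambda>i. source_value phase g nz i \<omega>) {Scatter m k}))"
    by (rule indep_vars_disjoint_functions[OF assms])
       (auto simp: borel_prod[symmetric])
  then show ?thesis by simp
qed

text \<open>At a fixed access point each channel uses only its own phase and scatter, and the
  correlated noise only the pilot noise, so the blocks \<open>K j\<close> of sources are disjoint.
  Index \<open>None\<close> stands for the noise and \<open>Some k\<close> for user
  \<open>k\<close>.\<close>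

lemma indep_vars_channel_noise:
  fixes phase :: "'m \<Rightarrow> 'k \<Rightarrow> 'a \<Rightarrow> real" and nz :: "'m \<Rightarrow> 'a \<Rightarrow> complex ^ 't::finite" and p :: "complex ^ 't"
  assumes "indep_vars (\<lambda>_. borel) (source_value phase g nz) UNIV"
  shows "indep_vars (\<lambda>_. borel)
    (\<lambda>j. case j of Some k \<Rightarrow> channel hbar phase g n k | None \<Rightarrow> \<lambda>\<omega>. herm_inner p (nz n \<omega>)) UNIV"
proof -
  define K :: "'k option \<Rightarrow> ('m, 'k) source set"
    where "K j = (case j of Some k \<Rightarrow> {Phase n k, Scatter n k} | None \<Rightarrow> {Pilot_Noise n})" for j
  define F :: "'k option \<Rightarrow> (('m, 'k) source \<Rightarrow> real \<times> complex \<times> (complex ^ 't)) \<Rightarrow> complex"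
    where "F j x = (case j of
      Some k \<Rightarrow> complex_of_real (hbar n k) * exp (\<i> * complex_of_real (fst (x (Phase n k))))
        + fst (snd (x (Scatter n k)))
    | None \<Rightarrow> herm_inner p (snd (snd (x (Pilot_Noise n)))))" for j x
  have "disjoint_family_on K UNIV"
    by (auto simp: disjoint_family_on_def K_def split: option.splits)
  then have "indep_vars (\<lambda>j. PiM (K j) (\<lambda>_. borel)) (\<lambda>j \<omega>. restrict (\<lambda>i. source_value phase g nz i \<omega>) (K j)) UNIV"
    by (intro indep_vars_restrict[OF assms]) auto
  moreover have "F j \<in> borel_measurable (PiM (K j) (\<lambda>_. borel))" for j
  proof (cases j)
    case None
    have [measurable]: "herm_inner p \<in> borel_measurable borel"
      unfolding herm_inner_def by (intro borel_measurable_continuous_onI continuous_intros)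
    show ?thesis
      using None unfolding F_def K_def by (simp add: borel_prod[symmetric])
  next
    case (Some k)
    have [measurable]: "(\<lambda>t. exp (\<i> * complex_of_real t)) \<in> borel_measurable borel"
      by (intro borel_measurable_continuous_onI continuous_intros)
    show ?thesis
      using Some unfolding F_def K_def by (simp add: borel_prod[symmetric])
  qed
  ultimately have "indep_vars (\<lambda>_. borel)
      (\<lambda>j \<omega>. F j (restrict (\<lambda>i. source_value phase g nz i \<omega>) (K j))) UNIV"
    by (rule indep_vars_compose2)
  also have "(\<lambda>j \<omega>. F j (restrict (\<lambda>i. source_value phase g nz i \<omega>) (K j)))
      = (\<lambda>j. case j of Some k \<Rightarrow> channel hbar phase g n k | None \<Rightarrow> \<lambda>\<omega>. herm_inner p (nz n \<omega>))"
    by (auto simp: fun_eq_iff F_def K_def channel_def split: option.splits)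
  finally show ?thesis .
qed

end

section \<open>Diagonal matrices and precoders\<close>

lemma diag_mat_add: "diag_mat d + diag_mat e = diag_mat (\<lambda>i. d i + e i)"
  by (simp add: diag_mat_def vec_eq_iff)

lemma diag_mat_scaleR: "c *\<^sub>R diag_mat d = diag_mat (\<lambda>i. c * d i)"
  by (simp add: diag_mat_def vec_eq_iff)

lemma diag_mat_mult: "diag_mat d ** diag_mat e = diag_mat (\<lambda>i. d i * e i)"
  by (simp add: diag_mat_def vec_eq_iff matrix_matrix_mult_def if_distrib[of "\<lambda>t. t * _"] cong: if_cong)

lemma trace_diag_mat: "trace (diag_mat d) = (\<Sum>i\<in>UNIV. d i)"
  by (simp add: diag_mat_def trace_def)

text \<open>\<open>matrix_inv\<close> is a choice: the matrix of reciprocals shows that an inverse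
  exists, and multiplying by it on the left identifies the chosen one.\<close>

lemma matrix_inv_diag_mat:
  fixes d :: "'n::finite \<Rightarrow> real"
  assumes "\<And>i. d i \<noteq> 0"
  shows "matrix_inv (diag_mat d) = diag_mat (\<lambda>i. inverse (d i))"
proof -
  let ?D = "diag_mat d" and ?E = "diag_mat (\<lambda>i. inverse (d i))"
  have one: "diag_mat (\<lambda>_. 1) = (mat 1 :: real ^ 'n ^ 'n)"
    by (simp add: diag_mat_def mat_def)
  have inv: "?D ** ?E = mat 1" "?E ** ?D = mat 1"
    using assms by (simp_all add: diag_mat_mult one)
  then have "?D ** matrix_inv ?D = mat 1"
    unfolding matrix_inv_def by (rule_tac someI2[of _ ?E]) auto
  then have "?E ** (?D ** matrix_inv ?D) = ?E"
    by simp
  then show ?thesis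
    by (simp add: matrix_mul_assoc inv)
qed

section \<open>Sums over users and noise, and scaling of the precoder\<close>

lemma sum_UNIV_option: "(\<Sum>j\<in>UNIV. f j) = f None + (\<Sum>k\<in>UNIV. f (Some k))"
  for f :: "'k::finite option \<Rightarrow> 'b::comm_monoid_add"
  by (simp add: UNIV_option_conv sum.reindex)

lemma mean_power_of_real_mult:
  "mean_power P (\<lambda>\<omega>. complex_of_real c * Y \<omega>) = c\<^sup>2 * mean_power P Y" if "prob_space P"
proof -
  interpret prob_space P by fact
  show ?thesis by (simp add: mean_power_def norm_mult power_mult_distrib)
qed

text \<open>The root mean power scales by the same positive \<open>c\<close>, which cancels. This is
  why both estimators lead to one precoder.\<close>

lemma mr_precoder_of_real_mult:
  assumes "prob_space P" "hhat m k = (\<lambda>\<omega>. complex_of_real c * Y \<omega>)" "c > 0"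
  shows "mr_precoder P hhat m k \<omega> = Y \<omega> / complex_of_real (sqrt (mean_power P Y))"
  using assms(3)
  by (simp add: mr_precoder_def assms(2) mean_power_of_real_mult[OF assms(1)] real_sqrt_mult)

section \<open>Pilot observations and downlink SINR\<close>

text \<open>An instance of \<open>indep_sum_moments\<close> for the channels of all users together
  with the correlated noise.\<close>

lemma pilot_obs_moments:
  fixes P :: "'w measure"
    and hbar \<beta> :: "'m \<Rightarrow> 'k::finite \<Rightarrow> real"
    and nz :: "'m \<Rightarrow> 'w \<Rightarrow> complex ^ 't::finite"
    and pidx :: "'k \<Rightarrow> 't"
  assumes P: "prob_space P"
    and \<beta>: "\<And>m k. \<beta> m k > 0"
    and phase: "\<And>m k. has_law P (phase m k) (uniform_measure lborel {-pi..pi})"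
    and scatter: "\<And>m k. has_law P (g m k) (complex_normal (\<beta> m k))"
    and pilots: "orthogonal_pilots pilots"
    and phat: "\<And>k. phat k > 0"
    and var_ul: "var_ul > 0"
    and noise: "\<And>m. has_law P (nz m) (complex_normal_vec var_ul)"
    and indep: "indep_sources P phase g nz"
  defines "h \<equiv> channel hbar phase g"
  defines "y \<equiv> pilot_obs pilots pidx phat h nz"
  defines "\<tau> \<equiv> real CARD('t)"
  shows "mean_power P (y n l) = \<tau> * lambda' hbar \<beta> pidx phat var_ul n l"
    and "prob_space.expectation P (\<lambda>\<omega>. cnj (h n l \<omega>) * y n l \<omega>)
      = complex_of_real (sqrt (phat l) * \<tau> * beta' hbar \<beta> n l)"
    and "mean_power P (\<lambda>\<omega>. cnj (h n k \<omega>) * y n l \<omega>)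
      = beta' hbar \<beta> n k * (\<tau> * lambda' hbar \<beta> pidx phat var_ul n l)
        + (if l \<in> pilot_group pidx k
           then phat k * \<tau>\<^sup>2 * ((\<beta> n k)\<^sup>2 + 2 * (hbar n k)\<^sup>2 * \<beta> n k) else 0)"
proof -
  interpret prob_space P by fact
  \<comment> \<open>The observation is the combination of the \<open>X j\<close> with coefficients
    \<open>a j\<close>; \<open>s j\<close> is the power of \<open>X j\<close>. Users outside the
    pilot group get coefficient 0, and the noise power is \<open>var_ul\<close> times the squared
    pilot norm.\<close>
  define X where "X = (\<lambda>j. case j of Some k \<Rightarrow> h n k | None \<Rightarrow> \<lambda>\<omega>. herm_inner (pilots (pidx l)) (nz n \<omega>))"
  define a where "a = (\<lambda>j. case j of Some k \<Rightarrow> if k \<in> pilot_group pidx l then sqrt (phat k) * \<tau> else 0 | None \<Rightarrow> 1)"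
  define s where "s = (\<lambda>j. case j of Some k \<Rightarrow> beta' hbar \<beta> n k | None \<Rightarrow> var_ul * \<tau>)"
  have src: "indep_vars (\<lambda>_. borel) (source_value phase g nz) UNIV"
    using indep phase scatter noise by (intro indep_vars_source_value) (auto simp: has_law_def)
  have ind: "indep_vars (\<lambda>_. borel) X UNIV"
    unfolding X_def h_def by (rule indep_vars_channel_noise[OF src])
  have norm_pilot: "(norm (pilots (pidx l)))\<^sup>2 = \<tau>"
    using pilots by (simp add: orthogonal_pilots_def \<tau>_def)
  have herm: "herm_inner p \<in> borel_measurable borel" for p :: "complex ^ 't"
    unfolding herm_inner_def by (intro borel_measurable_continuous_onI continuous_intros)
  have herm2: "(\<lambda>x. (cmod (herm_inner p x))\<^sup>2) \<in> borel_measurable borel" for p :: "complex ^ 't"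
    using herm[of p] by measurable
  have mean: "has_bochner_integral P (X j) 0" for j
  proof (cases j)
    case None
    then show ?thesis
      using has_bochner_integral_has_law[OF noise
          has_bochner_integral_complex_normal_vec_herm_inner(1)[OF var_ul] herm]
      by (simp add: X_def)
  next
    case (Some k)
    then show ?thesis
      using rician_moments(1)[OF phase scatter \<beta> indep_var_phase_scatter[OF src], of "hbar n k" n k]
      by (simp add: X_def h_def channel_def[abs_def])
  qed
  have power: "has_bochner_integral P (\<lambda>\<omega>. (cmod (X j \<omega>))\<^sup>2) (s j)" for j
  proof (cases j)
    case None
    then show ?thesis
      using has_bochner_integral_has_law[OF noise[of n]
          has_bochner_integral_complex_normal_vec_herm_inner(2)[OF var_ul, of "pilots (pidx l)"] herm2]
      by (simp add: X_def s_def norm_pilot)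
  next
    case (Some k)
    then show ?thesis
      using rician_moments(2)[OF phase scatter \<beta> indep_var_phase_scatter[OF src], of "hbar n k" n k]
      by (simp add: X_def s_def h_def channel_def[abs_def] beta'_def)
  qed
  \<comment> \<open>In this shape the difference \<open>q - (s k)\<^sup>2\<close> of
    \<open>indep_sum_moments\<close> is exactly the second bracket.\<close>
  have fourth: "has_bochner_integral P (\<lambda>\<omega>. cmod (X (Some k) \<omega>) ^ 4)
      ((s (Some k))\<^sup>2 + ((\<beta> n k)\<^sup>2 + 2 * (hbar n k)\<^sup>2 * \<beta> n k))" for k
    using rician_moments(3)[OF phase scatter \<beta> indep_var_phase_scatter[OF src], of "hbar n k" n k]
    by (simp add: X_def s_def h_def channel_def[abs_def] beta'_def)
  have y: "y n l \<omega> = (\<Sum>j\<in>UNIV. complex_of_real (a j) * X j \<omega>)" for \<omega>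
  proof -
    have "(\<Sum>k\<in>UNIV. complex_of_real (a (Some k)) * X (Some k) \<omega>)
        = (\<Sum>k\<in>pilot_group pidx l. complex_of_real (sqrt (phat k) * \<tau>) * h n k \<omega>)"
      by (rule sum.mono_neutral_cong_right) (auto simp: a_def X_def)
    then show ?thesis
      by (simp add: y_def pilot_obs_def sum_UNIV_option a_def X_def \<tau>_def)
  qed
  \<comment> \<open>Both contributions share a factor \<open>\<tau>\<close>: a user in the pilot
    group has squared coefficient \<open>phat k * \<tau>\<^sup>2\<close>, and the noise has power
    \<open>var_ul * \<tau>\<close>.\<close>
  have total: "(\<Sum>j\<in>UNIV. (a j)\<^sup>2 * s j) = \<tau> * lambda' hbar \<beta> pidx phat var_ul n l"
  proof -
    have "(\<Sum>k\<in>UNIV. (a (Some k))\<^sup>2 * s (Some k))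
        = (\<Sum>k\<in>pilot_group pidx l. \<tau> * (phat k * \<tau> * beta' hbar \<beta> n k))"
      using phat[THEN less_imp_le]
      by (intro sum.mono_neutral_cong_right) (auto simp: a_def s_def power_mult_distrib power2_eq_square[of \<tau>])
    then show ?thesis
      by (simp add: sum_UNIV_option lambda'_def sum_distrib_left distrib_left \<tau>_def)
         (simp add: a_def s_def \<tau>_def)
  qed
  note moments = indep_sum_moments[OF ind mean power, where a = a, folded y, unfolded total]
  show "mean_power P (y n l) = \<tau> * lambda' hbar \<beta> pidx phat var_ul n l"
    using moments(1) by (simp add: mean_power_def)
  show "expectation (\<lambda>\<omega>. cnj (h n l \<omega>) * y n l \<omega>)
      = complex_of_real (sqrt (phat l) * \<tau> * beta' hbar \<beta> n l)"
    using moments(2)[of "Some l"] by (simp add: X_def a_def s_def pilot_group_def)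
  \<comment> \<open>The coefficient of user \<open>k\<close> tests membership in the group of
    \<open>l\<close>, the claim the converse; sharing a pilot is symmetric.\<close>
  have "l \<in> pilot_group pidx k \<longleftrightarrow> k \<in> pilot_group pidx l"
    by (auto simp: pilot_group_def)
  then show "mean_power P (\<lambda>\<omega>. cnj (h n k \<omega>) * y n l \<omega>)
      = beta' hbar \<beta> n k * (\<tau> * lambda' hbar \<beta> pidx phat var_ul n l)
        + (if l \<in> pilot_group pidx k
           then phat k * \<tau>\<^sup>2 * ((\<beta> n k)\<^sup>2 + 2 * (hbar n k)\<^sup>2 * \<beta> n k) else 0)"
    using moments(3)[OF fourth, of k] phat[of k]
    by (simp add: mean_power_def X_def a_def s_def power_mult_distrib)
qed

section \<open>The precoders, their products with the channels, and the SINR\<close>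

theorem mainTheorem8:
  fixes P :: "'w measure"
    and hbar \<beta> \<rho> :: "'m::finite \<Rightarrow> 'k::finite \<Rightarrow> real"
    and phase :: "'m \<Rightarrow> 'k \<Rightarrow> 'w \<Rightarrow> real"
    and g symbol h y w_lmmse w_ls :: "'m \<Rightarrow> 'k \<Rightarrow> 'w \<Rightarrow> complex"
    and nz :: "'m \<Rightarrow> 'w \<Rightarrow> complex ^ 't::finite"
    and pilots :: "'t \<Rightarrow> complex ^ 't"
    and pidx :: "'k \<Rightarrow> 't"
    and phat :: "'k \<Rightarrow> real"
    and var_ul var_dl \<rho>_dl :: real
    and \<tau>p :: nat
    and \<beta>' lam' :: "'m \<Rightarrow> 'k \<Rightarrow> real"
    and h_lmmse h_ls :: "'m \<Rightarrow> 'k \<Rightarrow> 'w \<Rightarrow> complex"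
    and R L R' \<Lambda>' \<Omega>' D :: "'k \<Rightarrow> real ^ 'm ^ 'm"
  assumes "prob_space P"
    \<comment> \<open>channels\<close>
    and "\<And>m k. hbar m k \<ge> 0"
    and "\<And>m k. \<beta> m k > 0"
    and "\<And>m k. has_law P (phase m k) (uniform_measure lborel {-pi..pi})"
    and "\<And>m k. has_law P (g m k) (complex_normal (\<beta> m k))"
    and "h = channel hbar phase g"
    \<comment> \<open>pilots\<close>
    and "\<tau>p = CARD('t)"
    and "\<tau>p < CARD('k)"
    and "orthogonal_pilots pilots"
    and "\<And>k. phat k > 0"
    and "var_ul > 0"
    and "\<And>m. has_law P (nz m) (complex_normal_vec var_ul)"
    and "indep_sources P phase g nz"
    and "y = pilot_obs pilots pidx phat h nz"
    \<comment> \<open>estimators and precoders\<close>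
    and "\<beta>' = beta' hbar \<beta>"
    and "lam' = lambda' hbar \<beta> pidx phat var_ul"
    and "h_lmmse = lmmse_est hbar \<beta> pidx phat var_ul y"
    and "h_ls = ls_est \<tau>p phat y"
    and "w_lmmse = mr_precoder P h_lmmse"
    and "w_ls = mr_precoder P h_ls"
    \<comment> \<open>downlink data transmission\<close>
    and "\<And>m k. \<rho> m k \<ge> 0"
    and "\<And>m. (\<Sum>l\<in>UNIV. \<rho> m l) \<le> \<rho>_dl"
    and "\<And>m k. has_law P (symbol m k) (complex_normal (\<rho> m k))"
    and "prob_space.indep_vars P (\<lambda>_. borel) (\<lambda>(m, k). symbol m k) UNIV"
    and "var_dl > 0"
    \<comment> \<open>matrices\<close>
    and "\<And>k. R k = diag_mat (\<lambda>m. \<beta> m k)"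
    and "\<And>k. L k = diag_mat (\<lambda>m. (hbar m k)\<^sup>2)"
    and "\<And>k. R' k = R k + L k"
    and "\<And>k. \<Lambda>' k = matrix_inv (diag_mat (\<lambda>m. lam' m k))"
    and "\<And>k. \<Omega>' k = R' k ** \<Lambda>' k ** R' k"
    and "\<And>k. D k = diag_mat (\<lambda>m. \<rho> m k)"
  shows "(\<forall>m k. mean_power P (h_lmmse m k) = phat k * \<tau>p * (\<beta>' m k)\<^sup>2 * inverse (lam' m k))
    \<and> (\<forall>m k. mean_power P (h_ls m k) = 1 / (phat k * \<tau>p) * lam' m k)
    \<and> w_lmmse = w_ls
    \<and> (\<forall>w \<in> {w_lmmse, w_ls}. \<forall>n k l.
          prob_space.expectation P (\<lambda>\<omega>. cnj (h n k \<omega>) * w n k \<omega>)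
            = complex_of_real (sqrt (phat k * \<tau>p * (\<beta>' n k)\<^sup>2 * inverse (lam' n k)))
        \<and> mean_power P (\<lambda>\<omega>. cnj (h n k \<omega>) * w n l \<omega>)
            = \<beta>' n k + (if l \<in> pilot_group pidx k
                then phat k * \<tau>p * inverse (lam' n l) * ((\<beta> n k)\<^sup>2 + 2 * (hbar n k)\<^sup>2 * \<beta> n k)
                else 0))
    \<and> (\<forall>k. \<forall>w \<in> {w_lmmse, w_ls}. sinr_dl_nc P \<rho> var_dl h w k =
          phat k * \<tau>p * trace (D k ** \<Omega>' k)
          / ((\<Sum>l\<in>UNIV. trace (D l ** R' k))
             + (\<Sum>l\<in>pilot_group pidx k.
                  phat k * \<tau>p * trace (D l ** \<Lambda>' l ** (R k ** R k + 2 *\<^sub>R (R k ** L k))))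
             - phat k * \<tau>p * trace (D k ** \<Omega>' k) + var_dl))"
proof -
  interpret prob_space P by fact
  have h: "h = channel hbar phase g" and y: "y = pilot_obs pilots pidx phat h nz"
    and \<beta>': "\<beta>' = beta' hbar \<beta>" and lam': "lam' = lambda' hbar \<beta> pidx phat var_ul"
    and phat: "\<And>k. phat k > 0" and \<tau>: "real \<tau>p > 0"
    using assms by auto
  note moments = pilot_obs_moments[where hbar = hbar and pidx = pidx and phat = phat and \<beta> = \<beta>,
      OF assms(1,3,4,5,9,10,11,12,13), folded h, folded y, folded \<open>\<tau>p = CARD('t)\<close> \<beta>' lam']
  have \<beta>'_pos: "\<beta>' m k > 0" for m k
    using assms(3)[of m k] by (simp add: \<beta>' beta'_def add_pos_nonneg)
  have lam'_pos: "lam' m k > 0" for m k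
    unfolding lam' lambda'_def \<beta>'[symmetric]
    using phat \<beta>'_pos \<open>var_ul > 0\<close>
    by (intro add_nonneg_pos sum_nonneg mult_nonneg_nonneg) (auto intro: less_imp_le)
  \<comment> \<open>The positive factors by which the LMMSE and the LS estimator scale the
    observation.\<close>
  define c1 where "c1 m k = sqrt (phat k) * \<beta>' m k / lam' m k" for m k
  define c2 where "c2 k = 1 / (sqrt (phat k) * real \<tau>p)" for k
  have c_pos: "c1 m k > 0" "c2 k > 0" for m k
    using phat \<beta>'_pos lam'_pos \<tau> by (simp_all add: c1_def c2_def)
  have lmmse: "h_lmmse m k = (\<lambda>\<omega>. complex_of_real (c1 m k) * y m k \<omega>)" for m k
    by (simp add: fun_eq_iff \<open>h_lmmse = _\<close> lmmse_est_def c1_def \<beta>' lam')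
  have ls: "h_ls m k = (\<lambda>\<omega>. complex_of_real (c2 k) * y m k \<omega>)" for m k
    by (simp add: fun_eq_iff \<open>h_ls = _\<close> ls_est_def c2_def)
  define q where "q m k = real \<tau>p * lam' m k" for m k
  have q_pos: "q m k > 0" for m k
    using \<tau> lam'_pos by (simp add: q_def)
  have mean_power_y: "mean_power P (y m k) = q m k" for m k
    using moments(1) by (simp add: q_def)
  have power_lmmse: "mean_power P (h_lmmse m k) = phat k * \<tau>p * (\<beta>' m k)\<^sup>2 * inverse (lam' m k)" for m k
    unfolding lmmse mean_power_of_real_mult[OF assms(1)] mean_power_y
    using phat[of k] lam'_pos[of m k]
    by (simp add: q_def c1_def power_mult_distrib power_divide field_simps power2_eq_square[of "lam' m k"])
  have power_ls: "mean_power P (h_ls m k) = 1 / (phat k * \<tau>p) * lam' m k" for m k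
    unfolding ls mean_power_of_real_mult[OF assms(1)] mean_power_y
    using phat[of k] \<tau>
    by (simp add: q_def c2_def power_mult_distrib power_divide power2_eq_square[of "real \<tau>p"])
  \<comment> \<open>The common value of both precoders: \<open>y\<close> scaled to unit mean power.
    The remaining moments are computed once, for \<open>w\<close>.\<close>
  define w where "w = (\<lambda>m k \<omega>. complex_of_real (1 / sqrt (q m k)) * y m k \<omega>)"
  have "w_lmmse = w"
    unfolding \<open>w_lmmse = _\<close> w_def
    by (intro ext) (simp add: mr_precoder_of_real_mult[OF assms(1) lmmse c_pos(1)] mean_power_y)
  moreover have "w_ls = w"
    unfolding \<open>w_ls = _\<close> w_def
    by (intro ext) (simp add: mr_precoder_of_real_mult[OF assms(1) ls c_pos(2)] mean_power_y)
  moreover have Ew: "expectation (\<lambda>\<omega>. cnj (h n k \<omega>) * w n k \<omega>)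
      = complex_of_real (sqrt (phat k * \<tau>p * (\<beta>' n k)\<^sup>2 * inverse (lam' n k)))" for n k
  proof -
    have "expectation (\<lambda>\<omega>. cnj (h n k \<omega>) * w n k \<omega>)
        = expectation (\<lambda>\<omega>. complex_of_real (1 / sqrt (q n k)) * (cnj (h n k \<omega>) * y n k \<omega>))"
      by (simp add: w_def mult_ac)
    also have "\<dots> = complex_of_real (1 / sqrt (q n k)) * complex_of_real (sqrt (phat k) * \<tau>p * \<beta>' n k)"
      by (subst integral_mult_right_zero) (simp only: moments(2))
    also have "\<dots> = complex_of_real (1 / sqrt (q n k) * (sqrt (phat k) * \<tau>p * \<beta>' n k))"
      by (simp only: of_real_mult)
    \<comment> \<open>Both sides are nonnegative, so comparing squares suffices; dividing by
      \<open>q n k\<close> cancels one of the two factors \<open>\<tau>p\<close>.\<close>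
    also have "1 / sqrt (q n k) * (sqrt (phat k) * \<tau>p * \<beta>' n k)
        = sqrt (phat k * \<tau>p * (\<beta>' n k)\<^sup>2 * inverse (lam' n k))"
    proof (rule real_sqrt_unique[symmetric])
      show "(1 / sqrt (q n k) * (sqrt (phat k) * \<tau>p * \<beta>' n k))\<^sup>2
          = phat k * \<tau>p * (\<beta>' n k)\<^sup>2 * inverse (lam' n k)"
        using phat[of k] \<tau> lam'_pos[of n k] q_pos[of n k]
        by (simp add: power_mult_distrib power_divide)
           (simp add: q_def field_simps power2_eq_square[of "real \<tau>p"])
      show "0 \<le> 1 / sqrt (q n k) * (sqrt (phat k) * \<tau>p * \<beta>' n k)"
        using phat[of k] \<tau> \<beta>'_pos[of n k] q_pos[of n k] by simp
    qed
    finally show ?thesis .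
  qed
  moreover have Pw: "mean_power P (\<lambda>\<omega>. cnj (h n k \<omega>) * w n l \<omega>)
      = \<beta>' n k + (if l \<in> pilot_group pidx k
          then phat k * \<tau>p * inverse (lam' n l) * ((\<beta> n k)\<^sup>2 + 2 * (hbar n k)\<^sup>2 * \<beta> n k)
          else 0)" for n k l
  proof -
    have "mean_power P (\<lambda>\<omega>. cnj (h n k \<omega>) * w n l \<omega>)
        = mean_power P (\<lambda>\<omega>. complex_of_real (1 / sqrt (q n l)) * (cnj (h n k \<omega>) * y n l \<omega>))"
      by (simp add: w_def mult_ac)
    also have "\<dots> = 1 / q n l * mean_power P (\<lambda>\<omega>. cnj (h n k \<omega>) * y n l \<omega>)"
      using q_pos[of n l] by (simp only: mean_power_of_real_mult[OF assms(1)]) (simp add: power_divide)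
    finally have scaled: "mean_power P (\<lambda>\<omega>. cnj (h n k \<omega>) * w n l \<omega>)
        = 1 / q n l * mean_power P (\<lambda>\<omega>. cnj (h n k \<omega>) * y n l \<omega>)" .
    \<comment> \<open>Division by \<open>q n l\<close> removes the mean power of \<open>y\<close>
      from the first term and one factor \<open>\<tau>p\<close> from the second. Abstract reals keep
      the moments out of the simplification.\<close>
    have "1 / (T * x) * (b * (T * x) + (if c then p * T\<^sup>2 * B else 0))
        = b + (if c then p * T * inverse x * B else 0)" if "T > 0" "x > 0" for T x b p B :: real and c
      using that by (simp add: field_simps power2_eq_square)
    from this[OF \<tau> lam'_pos] show ?thesis
      unfolding scaled moments(3) q_def .
  qed
  moreover have "sinr_dl_nc P \<rho> var_dl h w k =
          phat k * \<tau>p * trace (D k ** \<Omega>' k)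
          / ((\<Sum>l\<in>UNIV. trace (D l ** R' k))
             + (\<Sum>l\<in>pilot_group pidx k.
                  phat k * \<tau>p * trace (D l ** \<Lambda>' l ** (R k ** R k + 2 *\<^sub>R (R k ** L k))))
             - phat k * \<tau>p * trace (D k ** \<Omega>' k) + var_dl)" for k
  proof -
    have \<Lambda>': "\<Lambda>' l = diag_mat (\<lambda>m. inverse (lam' m l))" for l
      using lam'_pos by (simp add: assms(29) matrix_inv_diag_mat less_imp_neq[symmetric])
    have R': "R' l = diag_mat (\<lambda>m. \<beta>' m l)" for l
      by (simp add: assms(26-28) diag_mat_add \<beta>' beta'_def)
    have signal: "(\<Sum>n\<in>UNIV. \<rho> n k * (cmod (expectation (\<lambda>\<omega>. cnj (h n k \<omega>) * w n k \<omega>)))\<^sup>2)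
        = phat k * \<tau>p * trace (D k ** \<Omega>' k)"
    proof -
      have "(cmod (expectation (\<lambda>\<omega>. cnj (h n k \<omega>) * w n k \<omega>)))\<^sup>2
          = phat k * \<tau>p * (\<beta>' n k)\<^sup>2 * inverse (lam' n k)" for n
        unfolding Ew using phat[of k] lam'_pos[of n k] by (simp)
      then show ?thesis
        by (simp add: assms(30,31) R' \<Lambda>' diag_mat_mult trace_diag_mat sum_distrib_left
            power2_eq_square mult_ac)
    qed
    have interference: "(\<Sum>n\<in>UNIV. \<Sum>l\<in>UNIV. \<rho> n l * mean_power P (\<lambda>\<omega>. cnj (h n k \<omega>) * w n l \<omega>))
        = (\<Sum>l\<in>UNIV. trace (D l ** R' k))
           + (\<Sum>l\<in>pilot_group pidx k.
                phat k * \<tau>p * trace (D l ** \<Lambda>' l ** (R k ** R k + 2 *\<^sub>R (R k ** L k))))"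
    proof -
      \<comment> \<open>Separates the part present for every user \<open>l\<close> from the part due
        to pilot sharing, and moves the sum over users outside so that the inner sums become
        traces.\<close>
      have separate: "(\<Sum>n\<in>UNIV. \<Sum>l\<in>UNIV. \<rho> n l * (b n + (if c l then G n l else 0)))
          = (\<Sum>l\<in>UNIV. \<Sum>n\<in>UNIV. \<rho> n l * b n)
            + (\<Sum>l\<in>UNIV. if c l then \<Sum>n\<in>UNIV. \<rho> n l * G n l else 0)" for b G c
        by (subst sum.swap, simp only: sum.distrib[symmetric], rule sum.cong)
           (auto simp: distrib_left sum.distrib)
      have "(\<Sum>n\<in>UNIV. \<Sum>l\<in>UNIV. \<rho> n l * mean_power P (\<lambda>\<omega>. cnj (h n k \<omega>) * w n l \<omega>))
          = (\<Sum>l\<in>UNIV. \<Sum>n\<in>UNIV. \<rho> n l * \<beta>' n k)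
            + (\<Sum>l\<in>UNIV. if l \<in> pilot_group pidx k then
                \<Sum>n\<in>UNIV. \<rho> n l * (phat k * \<tau>p * inverse (lam' n l) * ((\<beta> n k)\<^sup>2 + 2 * (hbar n k)\<^sup>2 * \<beta> n k))
                else 0)"
        unfolding Pw by (rule separate)
      also have "(\<Sum>l\<in>UNIV. \<Sum>n\<in>UNIV. \<rho> n l * \<beta>' n k) = (\<Sum>l\<in>UNIV. trace (D l ** R' k))"
        by (simp add: assms(31) R' diag_mat_mult trace_diag_mat)
      also have "(\<Sum>l\<in>UNIV. if l \<in> pilot_group pidx k then
                \<Sum>n\<in>UNIV. \<rho> n l * (phat k * \<tau>p * inverse (lam' n l) * ((\<beta> n k)\<^sup>2 + 2 * (hbar n k)\<^sup>2 * \<beta> n k))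
                else 0)
          = (\<Sum>l\<in>pilot_group pidx k.
                phat k * \<tau>p * trace (D l ** \<Lambda>' l ** (R k ** R k + 2 *\<^sub>R (R k ** L k))))"
        by (rule sum.mono_neutral_cong_right)
           (auto simp: assms(26,27,31) \<Lambda>' diag_mat_mult diag_mat_add diag_mat_scaleR trace_diag_mat
              sum_distrib_left power2_eq_square algebra_simps intro!: sum.cong)
      finally show ?thesis .
    qed
    show ?thesis
      unfolding sinr_dl_nc_def signal interference ..
  qed
  ultimately show ?thesis
    using power_lmmse power_ls by (simp)
qed

end
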